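(* Restricted to instances with $r=0$ (all arcs have weight $1$), the problem Effectors is in $\mathsf{XP}$ with respect to each of the following three parameters separately: the number $a=|A|$ of target nodes, the budget $b$, and the cost $c$.
   Context: An influence graph $G=(V,E,w)$ is a finite simple directed graph (no loops) with a weight function $w:E\to(0,1]\cap\mathbb{Q}$; $r:=|\{u\to v\in E: w(u\to v)<1\}|$ is the number of probabilistic arcs. Independent Cascade process started from $X\subseteq V$: at time $0$ exactly the nodes in $X$ are active. When a node $u$ becomes active for the first time, at time step $t$, it gets a single chance to activate each currently inactive out-neighbor $v$, succeeding with probability $w(u\to v)$, all attempts being independent; if it succeeds, $v$ becomes active at step $t+1$; if it fails, $u$ makes no further attempts on $v$. Active nodes stay active. The process terminates when there are no newly activated nodes. Let $p(v|X)$ be the probability that $v$ is active upon termination. (If $r=0$, then $p(v|X)=1$ if $v$ is reachable by a directed path from $X$, and $p(v|X)=0$ otherwise.) Cost: for $A\subseteq V$ and $X\subseteq V$, $C_A(G,X):=\sum_{v\in A}(1-p(v|X))+\sum_{v\in V\setminus A}p(v|X)$. Effectors: given an influence graph $G=(V,E,w)$, a set of target nodes $A\subseteq V$, a budget $b\in\mathbb{N}$ and a cost $c\in\mathbb{Q}$, decide whether there is a set $X\subseteq V$ (of effectors) with $|X|\le b$ and $C_A(G,X)\le c$. When $r=0$ all costs $C_A(G,X)$ are nonnegative integers, so $c$ is taken to be a nonnegative integer when it serves as parameter. A parameterized problem with instances $(I,k)$ is in $\mathsf{XP}$ if it can be solved in $|I|^{f(k)}$ time for some computable function $f$. *)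

theory Defs
  imports "HOL-Probability.Probability" "Graph_Theory.Pair_Digraph"
begin

section \<open>Influence graphs and the Independent Cascade process\<close>

locale influence_graph = pair_digraph G for G :: "'v pair_pre_digraph" +
  fixes w :: "'v \<times> 'v \<Rightarrow> rat"
  assumes weight_pos: "e \<in> parcs G \<Longrightarrow> 0 < w e"
    and weight_le_1: "e \<in> parcs G \<Longrightarrow> w e \<le> 1"

definition probabilistic_arcs :: "'v pair_pre_digraph \<Rightarrow> ('v \<times> 'v \<Rightarrow> rat) \<Rightarrow> nat" where
  "probabilistic_arcs G w = card {e \<in> parcs G. w e < 1}"

text \<open>
  A state of the process is a pair \<open>(S, N)\<close>: the active nodes and, among them, those
  that became active in the current time step. Only nodes in \<open>N\<close> make attempts, so every
  arc is used at most once.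
\<close>

definition attempts :: "'v pair_pre_digraph \<Rightarrow> 'v set \<times> 'v set \<Rightarrow> ('v \<times> 'v) set" where
  "attempts G \<sigma> = {(u, v) \<in> parcs G. u \<in> snd \<sigma> \<and> v \<notin> fst \<sigma>}"

definition cascade_step ::
  "'v pair_pre_digraph \<Rightarrow> ('v \<times> 'v \<Rightarrow> rat) \<Rightarrow> 'v set \<times> 'v set \<Rightarrow> ('v set \<times> 'v set) pmf" where
  "cascade_step G w \<sigma> =
     map_pmf (\<lambda>success. let new = snd ` {e \<in> attempts G \<sigma>. success e} in (fst \<sigma> \<union> new, new))
       (Pi_pmf (attempts G \<sigma>) False (\<lambda>e. bernoulli_pmf (real_of_rat (w e))))"

primrec cascade ::
  "'v pair_pre_digraph \<Rightarrow> ('v \<times> 'v \<Rightarrow> rat) \<Rightarrow> 'v set \<Rightarrow> nat \<Rightarrow> ('v set \<times> 'v set) pmf" where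
  "cascade G w X 0 = return_pmf (X, X)"
| "cascade G w X (Suc t) = bind_pmf (cascade G w X t) (cascade_step G w)"

text \<open>
  By time \<open>|V|\<close> the process has terminated with certainty, so its state at that time is
  its state upon termination.
\<close>

lemma (in influence_graph) cascade_invariant:
  assumes "X \<subseteq> pverts G" and "\<sigma> \<in> set_pmf (cascade G w X t)"
  shows "snd \<sigma> \<subseteq> fst \<sigma> \<and> fst \<sigma> \<subseteq> pverts G \<and> (snd \<sigma> \<noteq> {} \<longrightarrow> t < card (fst \<sigma>))"
  using assms(2)
proof (induction t arbitrary: \<sigma>)
  case 0
  have "finite X" using assms(1) pair_finite_verts finite_subset by blast
  then show ?case using 0 assms(1) by (auto simp: card_gt_0_iff)
next
  case (Suc t)
  from Suc.prems obtain \<tau> f where \<tau>: "\<tau> \<in> set_pmf (cascade G w X t)"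
    and \<sigma>: "\<sigma> = (let new = snd ` {e \<in> attempts G \<tau>. f e} in (fst \<tau> \<union> new, new))"
    by (auto simp: cascade_step_def)
  define new where "new = snd ` {e \<in> attempts G \<tau>. f e}"
  note IH = Suc.IH[OF \<tau>]
  have sub: "new \<subseteq> pverts G" "new \<inter> fst \<tau> = {}"
    using arc_snd_in_verts unfolding new_def attempts_def by fastforce+
  have fin: "finite (fst \<tau>)" "finite new"
    using IH sub pair_finite_verts finite_subset by blast+
  have "Suc t < card (fst \<tau> \<union> new)" if "new \<noteq> {}"
  proof -
    have "snd \<tau> \<noteq> {}" using that unfolding new_def attempts_def by auto
    then have "t < card (fst \<tau>)" using IH by blast
    moreover have "0 < card new" using that fin by (simp add: card_gt_0_iff)
    moreover have "card (fst \<tau> \<union> new) = card (fst \<tau>) + card new"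
      using fin sub by (intro card_Un_disjoint) auto
    ultimately show ?thesis by linarith
  qed
  then show ?case using \<sigma> IH sub unfolding new_def[symmetric] by (auto simp: Let_def)
qed

lemma (in influence_graph) cascade_terminated:
  assumes "X \<subseteq> pverts G" and "\<sigma> \<in> set_pmf (cascade G w X (card (pverts G)))"
  shows "snd \<sigma> = {}"
  using cascade_invariant[OF assms] card_mono[OF pair_finite_verts] by (meson not_less)

definition activation_prob ::
  "'v pair_pre_digraph \<Rightarrow> ('v \<times> 'v \<Rightarrow> rat) \<Rightarrow> 'v set \<Rightarrow> 'v \<Rightarrow> real" where
  "activation_prob G w X v =
     measure_pmf.prob (cascade G w X (card (pverts G))) {\<sigma>. v \<in> fst \<sigma>}"

definition effector_cost ::
  "'v pair_pre_digraph \<Rightarrow> ('v \<times> 'v \<Rightarrow> rat) \<Rightarrow> 'v set \<Rightarrow> 'v set \<Rightarrow> real" where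
  "effector_cost G w A X =
     (\<Sum>v\<in>A. 1 - activation_prob G w X v) + (\<Sum>v\<in>pverts G - A. activation_prob G w X v)"


section \<open>The problem Effectors\<close>

record 'v effectors_instance =
  graph :: "'v pair_pre_digraph"
  weight :: "'v \<times> 'v \<Rightarrow> rat"
  targets :: "'v set"
  budget :: nat
  cost :: rat

definition effectors_instances :: "'v effectors_instance set" where
  "effectors_instances =
     {I. influence_graph (graph I) (weight I) \<and> targets I \<subseteq> pverts (graph I)}"

definition deterministic_instances :: "'v effectors_instance set" where
  "deterministic_instances =
     {I \<in> effectors_instances. probabilistic_arcs (graph I) (weight I) = 0}"

definition effectors :: "'v effectors_instance \<Rightarrow> bool" where
  "effectors I \<longleftrightarrow> (\<exists>X. X \<subseteq> pverts (graph I) \<and> card X \<le> budget I \<and>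
     effector_cost (graph I) (weight I) (targets I) X \<le> real_of_rat (cost I))"

text \<open>
  Instances are encoded as bit strings, relative to an enumeration of the vertices.
  Numbers are written in binary (least significant bit first); each digit is preceded by
  \<open>True\<close> and the number is ended by \<open>False\<close>, which makes the code
  prefix-free. The graph is given by its weighted adjacency matrix, row by row.
\<close>

fun binary :: "nat \<Rightarrow> bool list" where
  "binary n = (if n = 0 then [] else odd n # binary (n div 2))"

declare binary.simps [simp del]

definition encode_nat :: "nat \<Rightarrow> bool list" where
  "encode_nat n = concat (map (\<lambda>d. [True, d]) (binary n)) @ [False]"

definition encode_rat :: "rat \<Rightarrow> bool list" where
  "encode_rat q = (let (m, d) = quotient_of q
     in (m < 0) # encode_nat (nat \<bar>m\<bar>) @ encode_nat (nat d))"

definition encode_instance :: "'v list \<Rightarrow> 'v effectors_instance \<Rightarrow> bool list" where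
  "encode_instance vs I =
     encode_nat (length vs) @
     concat (map (\<lambda>e. if e \<in> parcs (graph I) then True # encode_rat (weight I e) else [False])
       (List.product vs vs)) @
     map (\<lambda>v. v \<in> targets I) vs @
     encode_nat (budget I) @
     encode_rat (cost I)"

definition instance_code :: "'v effectors_instance \<Rightarrow> bool list \<Rightarrow> bool" where
  "instance_code I x \<longleftrightarrow>
     (\<exists>vs. distinct vs \<and> set vs = pverts (graph I) \<and> x = encode_instance vs I)"

lemma instance_code_exists:
  assumes "I \<in> effectors_instances"
  shows "\<exists>x. instance_code I x"
proof -
  have "finite (pverts (graph I))"
    using assms unfolding effectors_instances_def influence_graph_def
    by (auto dest: pair_digraph.axioms pair_fin_digraph.pair_finite_verts)
  then show ?thesis
    unfolding instance_code_def using finite_distinct_list by blast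
qed

lemma instance_code_length:
  assumes "instance_code I x"
  shows "2 \<le> length x"
proof -
  obtain vs where "x = encode_instance vs I" using assms unfolding instance_code_def by blast
  then show ?thesis by (simp add: encode_instance_def encode_nat_def)
qed


section \<open>Random access machines and the class XP\<close>

text \<open>
  The machine model is the random access machine with unit cost, written with structured
  control flow. It has finitely many registers per program, named by strings, and an
  unbounded memory with indirect addressing; the only arithmetic operations are addition and
  truncated subtraction. As there is no multiplication, the numbers occurring in the first
  \<open>t\<close> steps have at most \<open>t\<close> bits more than the constants of the program
  and the numbers in the input, so time is polynomially related to that of
  Turing machines (Papadimitriou, Computational Complexity, Section 2.6).
\<close>

type_synonym reg = string
type_synonym ram_state = "(reg \<Rightarrow> nat) \<times> (nat \<Rightarrow> nat)"

datatype com =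
    Const reg nat
  | Copy reg reg
  | Add reg reg reg
  | Sub reg reg reg
  | Load reg reg
  | Store reg reg
  | Seq com com
  | IfNZ reg com com
  | WhileNZ reg com

text \<open>\<open>exec P \<sigma> t \<sigma>'\<close>: started in \<open>\<sigma>\<close>, \<open>P\<close> halts after
  \<open>t\<close> steps in \<open>\<sigma>'\<close>.\<close>

inductive exec :: "com \<Rightarrow> ram_state \<Rightarrow> nat \<Rightarrow> ram_state \<Rightarrow> bool" where
  Const: "exec (Const x k) (r, m) 1 (r(x := k), m)"
| Copy: "exec (Copy x y) (r, m) 1 (r(x := r y), m)"
| Add: "exec (Add x y z) (r, m) 1 (r(x := r y + r z), m)"
| Sub: "exec (Sub x y z) (r, m) 1 (r(x := r y - r z), m)"
| Load: "exec (Load x y) (r, m) 1 (r(x := m (r y)), m)"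
| Store: "exec (Store x y) (r, m) 1 (r, m(r x := r y))"
| Seq: "exec P \<sigma> t \<sigma>' \<Longrightarrow> exec Q \<sigma>' t' \<sigma>'' \<Longrightarrow> exec (Seq P Q) \<sigma> (t + t') \<sigma>''"
| IfTrue: "fst \<sigma> x \<noteq> 0 \<Longrightarrow> exec P \<sigma> t \<sigma>' \<Longrightarrow> exec (IfNZ x P Q) \<sigma> (t + 1) \<sigma>'"
| IfFalse: "fst \<sigma> x = 0 \<Longrightarrow> exec Q \<sigma> t \<sigma>' \<Longrightarrow> exec (IfNZ x P Q) \<sigma> (t + 1) \<sigma>'"
| WhileTrue: "fst \<sigma> x \<noteq> 0 \<Longrightarrow> exec P \<sigma> t \<sigma>' \<Longrightarrow> exec (WhileNZ x P) \<sigma>' t' \<sigma>'' \<Longrightarrow>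
    exec (WhileNZ x P) \<sigma> (t + t' + 1) \<sigma>''"
| WhileFalse: "fst \<sigma> x = 0 \<Longrightarrow> exec (WhileNZ x P) \<sigma> 1 \<sigma>"

inductive_cases exec_elims:
  "exec (Const x k) \<sigma> t \<tau>" "exec (Copy x y) \<sigma> t \<tau>" "exec (Add x y z) \<sigma> t \<tau>"
  "exec (Sub x y z) \<sigma> t \<tau>" "exec (Load x y) \<sigma> t \<tau>" "exec (Store x y) \<sigma> t \<tau>"
inductive_cases exec_SeqE: "exec (Seq P Q) \<sigma> t \<tau>"
inductive_cases exec_IfNZE: "exec (IfNZ x P Q) \<sigma> t \<tau>"
inductive_cases exec_WhileNZE: "exec (WhileNZ x P) \<sigma> t \<tau>"

lemma exec_deterministic: "exec P \<sigma> t \<tau> \<Longrightarrow> exec P \<sigma> t' \<tau>' \<Longrightarrow> t = t' \<and> \<tau> = \<tau>'"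
proof (induction arbitrary: t' \<tau>' rule: exec.induct)
  case (Seq P \<sigma> t \<sigma>' Q t2 \<sigma>'')
  from Seq.prems obtain t1' t2' \<rho>
    where *: "exec P \<sigma> t1' \<rho>" "exec Q \<rho> t2' \<tau>'" "t' = t1' + t2'"
    by (rule exec_SeqE)
  have "t = t1' \<and> \<sigma>' = \<rho>" by (rule Seq.IH(1)[OF *(1)])
  with Seq.IH(2)[of t2' \<tau>'] * show ?case by simp
next
  case (IfTrue \<sigma> x P t \<sigma>' Q)
  from IfTrue.prems obtain t1 where *: "exec P \<sigma> t1 \<tau>'" "t' = t1 + 1"
    by (rule exec_IfNZE) (use IfTrue.hyps in simp_all)
  with IfTrue.IH[OF *(1)] show ?case by simp
next
  case (IfFalse \<sigma> x Q t \<sigma>' P)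
  from IfFalse.prems obtain t1 where *: "exec Q \<sigma> t1 \<tau>'" "t' = t1 + 1"
    by (rule exec_IfNZE) (use IfFalse.hyps in simp_all)
  with IfFalse.IH[OF *(1)] show ?case by simp
next
  case (WhileTrue \<sigma> x P t \<sigma>' t2 \<sigma>'')
  from WhileTrue.prems obtain t1' t2' \<rho>
    where *: "exec P \<sigma> t1' \<rho>" "exec (WhileNZ x P) \<rho> t2' \<tau>'" "t' = t1' + t2' + 1"
    by (rule exec_WhileNZE) (use WhileTrue.hyps in simp_all)
  have "t = t1' \<and> \<sigma>' = \<rho>" by (rule WhileTrue.IH(1)[OF *(1)])
  with WhileTrue.IH(2)[of t2' \<tau>'] * show ?case by simp
next
  case (WhileFalse \<sigma> x P)
  from WhileFalse.prems show ?case
    by (rule exec_WhileNZE) (use WhileFalse.hyps in simp_all)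
qed (erule exec_elims; simp)+

definition nat_input :: "nat \<Rightarrow> ram_state" where
  "nat_input k = ((\<lambda>_. 0)(''n'' := k), \<lambda>_. 0)"

definition bits_input :: "bool list \<Rightarrow> ram_state" where
  "bits_input x =
     ((\<lambda>_. 0)(''n'' := length x), \<lambda>i. if i < length x then of_bool (x ! i) else 0)"

definition computable :: "(nat \<Rightarrow> nat) \<Rightarrow> bool" where
  "computable f \<longleftrightarrow> (\<exists>P. \<forall>k. \<exists>t \<sigma>. exec P (nat_input k) t \<sigma> \<and> fst \<sigma> ''out'' = f k)"

definition answers_within :: "com \<Rightarrow> bool list \<Rightarrow> bool \<Rightarrow> nat \<Rightarrow> bool" where
  "answers_within P x answer T \<longleftrightarrow>
     (\<exists>t \<sigma>. exec P (bits_input x) t \<sigma> \<and> t \<le> T \<and> fst \<sigma> ''out'' = of_bool answer)"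

text \<open>
  A parameterized problem is given by its set of instances \<open>(I, k)\<close>, its yes-instances
  and an encoding. One program has to handle all values of the parameter.
\<close>

definition in_XP :: "('i \<times> nat) set \<Rightarrow> ('i \<Rightarrow> bool) \<Rightarrow> ('i \<Rightarrow> bool list \<Rightarrow> bool) \<Rightarrow> bool" where
  "in_XP instances yes code \<longleftrightarrow>
     (\<exists>f P. computable f \<and>
       (\<forall>(I, k) \<in> instances. \<forall>x. code I x \<longrightarrow> answers_within P x (yes I) (length x ^ f k)))"

end

theory Submission
  imports Defs
begin

text \<open>
  When all arcs have weight 1, the nodes active at the end are those reachable from \<open>X\<close>, so the
  cost is the size of the symmetric difference of \<open>A\<close> and the closure of \<open>X\<close>.

  For the parameters \<open>a\<close> and \<open>b\<close>: choosing for each target activated by \<open>X\<close> one effector that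
  reaches it gives at most \<open>a\<close> effectors that activate the same targets and no further nodes.
  Hence it suffices to try all sets of at most \<open>min a b\<close> nodes.

  For the parameter \<open>c\<close>: try all sets \<open>S\<close> of at most \<open>c\<close> nodes as the set of nodes in the wrong
  state. The active set is then the symmetric difference \<open>R\<close> of \<open>A\<close> and \<open>S\<close>, and it remains to find
  the least number of effectors that activate exactly \<open>R\<close>. Deleting nodes from \<open>R\<close> greedily as
  long as the remaining ones still generate \<open>R\<close> attains this minimum.
\<close>


section \<open>The machine\<close>

text \<open>For the parameter \<open>c\<close> the effectors themselves cannot be enumerated,
  because the budget may be as large as \<open>n\<close>. Guessing the few errors fixes the active
  set \<open>R\<close>, and what remains is polynomial: an inclusion-minimal generating set of
  \<open>R\<close> takes exactly one node from each source component of \<open>R\<close>, so all of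
  them have the same size. The parameter is not part of the input. Each program derives its
  enumeration bound, \<open>min a b\<close> or the numerator of the cost, from the instance, and any
  bound not exceeding the parameter fits the exponent. A program has a fixed nesting depth and the
  machine neither multiplies nor divides, so \<open>k\<close>-element sets cannot be listed by
  \<open>k\<close> nested loops. A single counter runs through the numbers below
  \<open>(n + 1) ^ k\<close> instead, and each is decoded into \<open>k\<close> digits by counting.
  Decoding one code takes time proportional to its value, which squares the factor
  \<open>(n + 1) ^ k\<close> and is still of the form \<open>length x ^ f k\<close>.\<close>

definition wp :: "com \<Rightarrow> (nat \<Rightarrow> (reg \<Rightarrow> nat) \<Rightarrow> (nat \<Rightarrow> nat) \<Rightarrow> bool) \<Rightarrow> (reg \<Rightarrow> nat) \<Rightarrow> (nat \<Rightarrow> nat) \<Rightarrow> bool" where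
  "wp P Q r m \<longleftrightarrow> (\<exists>t r' m'. exec P (r, m) t (r', m') \<and> Q t r' m')"

lemma wp_mono:
  assumes "wp P Q r m" "\<And>t r' m'. Q t r' m' \<Longrightarrow> Q' t r' m'"
  shows "wp P Q' r m"
  using assms unfolding wp_def by blast

text \<open>Execution is deterministic, so the run promised by \<open>wp\<close> is the only one and
  a known run decides the postcondition. This makes the rules below equivalences that
  \<open>simp\<close> can evaluate, with the step count as part of the postcondition.\<close>

lemma wp_exec: "exec P (r, m) t (r', m') \<Longrightarrow> wp P Q r m \<longleftrightarrow> Q t r' m'"
  unfolding wp_def by (metis exec_deterministic prod.inject)

lemma wp_basic [simp]:
  "wp (Const x k) Q r m \<longleftrightarrow> Q 1 (r(x := k)) m"
  "wp (Copy x y) Q r m \<longleftrightarrow> Q 1 (r(x := r y)) m"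
  "wp (Add x y z) Q r m \<longleftrightarrow> Q 1 (r(x := r y + r z)) m"
  "wp (Sub x y z) Q r m \<longleftrightarrow> Q 1 (r(x := r y - r z)) m"
  "wp (Load x y) Q r m \<longleftrightarrow> Q 1 (r(x := m (r y))) m"
  "wp (Store x y) Q r m \<longleftrightarrow> Q 1 r (m(r x := r y))"
  by (rule wp_exec, rule exec.intros)+

lemma wp_Seq [simp]: "wp (Seq P P') Q r m \<longleftrightarrow> wp P (\<lambda>t. wp P' (\<lambda>t'. Q (t + t'))) r m"
proof
  assume "wp (Seq P P') Q r m"
  then obtain t r' m' where "exec (Seq P P') (r, m) t (r', m')" "Q t r' m'"
    unfolding wp_def by blast
  then show "wp P (\<lambda>t. wp P' (\<lambda>t'. Q (t + t'))) r m"
    unfolding wp_def by (elim exec_SeqE) (metis surj_pair)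
qed (unfold wp_def, blast intro: exec.Seq)

lemma wp_IfNZ [simp]:
  "wp (IfNZ x P P') Q r m \<longleftrightarrow>
     (if r x \<noteq> 0 then wp P (\<lambda>t. Q (t + 1)) r m else wp P' (\<lambda>t. Q (t + 1)) r m)"
proof
  assume "wp (IfNZ x P P') Q r m"
  then obtain t r' m' where "exec (IfNZ x P P') (r, m) t (r', m')" "Q t r' m'"
    unfolding wp_def by blast
  then show "if r x \<noteq> 0 then wp P (\<lambda>t. Q (t + 1)) r m else wp P' (\<lambda>t. Q (t + 1)) r m"
    unfolding wp_def by (elim exec_IfNZE) auto
next
  assume "if r x \<noteq> 0 then wp P (\<lambda>t. Q (t + 1)) r m else wp P' (\<lambda>t. Q (t + 1)) r m"
  then show "wp (IfNZ x P P') Q r m"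
    unfolding wp_def using exec.IfTrue[of "(r, m)" x P] exec.IfFalse[of "(r, m)" x P']
    by (simp split: if_splits) blast+
qed

text \<open>Unrolls a loop once. Unlike its neighbours it is not a simp rule, since the same loop
  occurs again on the right-hand side.\<close>

lemma wp_WhileNZ:
  "wp (WhileNZ x P) Q r m \<longleftrightarrow>
     (if r x \<noteq> 0 then wp P (\<lambda>t. wp (WhileNZ x P) (\<lambda>t'. Q (t + t' + 1))) r m else Q 1 r m)"
proof
  assume "wp (WhileNZ x P) Q r m"
  then obtain t r' m' where *: "exec (WhileNZ x P) (r, m) t (r', m')" "Q t r' m'"
    unfolding wp_def by blast
  from *(1) show "if r x \<noteq> 0 then wp P (\<lambda>t. wp (WhileNZ x P) (\<lambda>t'. Q (t + t' + 1))) r m else Q 1 r m"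
    unfolding wp_def by (rule exec_WhileNZE) (use *(2) in simp_all, metis surj_pair)
next
  assume *: "if r x \<noteq> 0 then wp P (\<lambda>t. wp (WhileNZ x P) (\<lambda>t'. Q (t + t' + 1))) r m else Q 1 r m"
  show "wp (WhileNZ x P) Q r m"
  proof (cases "r x = 0")
    case True
    then show ?thesis
      using * wp_exec[OF exec.WhileFalse[of "(r, m)" x P]] by simp
  next
    case False
    with * obtain t r' m' t' s m'' where "exec P (r, m) t (r', m')"
      "exec (WhileNZ x P) (r', m') t' (s, m'')" "Q (t + t' + 1) s m''"
      unfolding wp_def by auto
    then show ?thesis
      unfolding wp_def using exec.WhileTrue[of "(r, m)" x P] False by fastforce
  qed
qed

primrec written :: "com \<Rightarrow> reg set" where
  "written (Const x k) = {x}"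
| "written (Copy x y) = {x}"
| "written (Add x y z) = {x}"
| "written (Sub x y z) = {x}"
| "written (Load x y) = {x}"
| "written (Store x y) = {}"
| "written (Seq P Q) = written P \<union> written Q"
| "written (IfNZ x P Q) = written P \<union> written Q"
| "written (WhileNZ x P) = written P"

lemma exec_written: "exec P \<sigma> t \<sigma>' \<Longrightarrow> x \<notin> written P \<Longrightarrow> fst \<sigma>' x = fst \<sigma> x"
  by (induction rule: exec.induct) auto

text \<open>The syntactic set \<open>written\<close> bounds the effect of every run, so a frame
  condition can be attached to any specification afterwards and specifications need only mention
  what changes.\<close>

lemma wp_written:
  assumes "wp P Q r m"
  shows "wp P (\<lambda>t r' m'. Q t r' m' \<and> (\<forall>x. x \<notin> written P \<longrightarrow> r' x = r x)) r m"
  using assms exec_written unfolding wp_def by fastforce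

abbreviation Then (infixr ";;" 60) where "P ;; Q \<equiv> Seq P Q"
text \<open>\<open>Skip\<close> clobbers the register \<open>t\<close>, which is harmless because \<open>For\<close> recomputes it
  before each test; for the same reason all nested loops can share it.\<close>

abbreviation Skip where "Skip \<equiv> Const ''t'' 0"

definition For :: "reg \<Rightarrow> reg \<Rightarrow> com \<Rightarrow> com" where
  "For i n P = Const i 0 ;; Sub ''t'' n i ;; WhileNZ ''t'' (P ;; Add i i ''1'' ;; Sub ''t'' n i)"

lemma written_For [simp]: "written (For i n P) = insert i (insert ''t'' (written P))"
  unfolding For_def by auto

text \<open>Each round adds 3 steps to those of the body: increment, recomputed difference and test.
  Another 3 are the two initial assignments and the last test. The invariant must be insensitive to
  \<open>i\<close> and \<open>''t''\<close>, which are reassigned after the body. When the rule is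
  applied with \<open>goal_cases\<close>, the cases 10, 11, 12 and 13 are \<open>init\<close>,
  \<open>step\<close>, \<open>ins\<close> and \<open>fin\<close>.\<close>

lemma wp_For:
  assumes n: "r n = N" and one: "r ''1'' = 1"
    and dist: "i \<noteq> n" "i \<noteq> ''t''" "n \<noteq> ''t''" "i \<noteq> ''1''"
      "i \<notin> written P" "n \<notin> written P" "''1'' \<notin> written P"
    and init: "I 0 r m"
    and step: "\<And>k r' m'. k < N \<Longrightarrow> I k r' m' \<Longrightarrow> r' i = k \<Longrightarrow>
      (\<forall>x. x \<notin> insert i (insert ''t'' (written P)) \<longrightarrow> r' x = r x) \<Longrightarrow>
      wp P (\<lambda>t r'' m''. t \<le> T \<and> I (Suc k) r'' m'') r' m'"
    and ins: "\<And>k r m a b. I k r m \<Longrightarrow> I k (r(i := a, ''t'' := b)) m"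
    and fin: "\<And>t r' m'. I N r' m' \<Longrightarrow>
      (\<forall>x. x \<notin> insert i (insert ''t'' (written P)) \<longrightarrow> r' x = r x) \<Longrightarrow>
      t \<le> 3 + N * (T + 3) \<Longrightarrow> Q t r' m'"
  shows "wp (For i n P) Q r m"
proof -
  let ?W = "WhileNZ ''t'' (P ;; Add i i ''1'' ;; Sub ''t'' n i)"
  let ?F = "\<lambda>r'. \<forall>x. x \<notin> insert i (insert ''t'' (written P)) \<longrightarrow> r' x = r x"
  \<comment> \<open>The claim is generalised to an arbitrary counter value \<open>k\<close>, for an
    induction on the number \<open>N - k\<close> of remaining rounds, which is also the value of
    \<open>''t''\<close>.\<close>
  have loop: "wp ?W (\<lambda>t r'' m''. I N r'' m'' \<and> ?F r'' \<and> t \<le> 1 + (N - k) * (T + 3)) r' m'"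
    if "k \<le> N" "I k r' m'" "?F r'" "r' i = k" "r' ''t'' = N - k" for k r' m'
    using that
  proof (induction "N - k" arbitrary: k r' m')
    case 0
    then show ?case by (subst wp_WhileNZ) simp
  next
    case (Suc d)
    note step_prems = Suc.prems
    have step_hyps: "k < N" "N - k \<noteq> 0" using Suc.hyps(2) by auto
    have "wp P (\<lambda>t r'' m''. t \<le> T \<and> I (Suc k) r'' m'') r' m'"
      by (rule assms(11)) (use step_prems step_hyps in auto)
    note body = wp_written[OF this]
    have nz: "r' ''t'' \<noteq> 0" using step_prems step_hyps by simp
    show ?case
    proof (subst wp_WhileNZ, simp only: nz if_True simp_thms wp_Seq, rule wp_mono[OF body], clarify, goal_cases)
      case (1 t r'' m'')
      note inv = ins[OF \<open>I (Suc k) r'' m''\<close>]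
      have *: "r'' n = N" "r'' ''1'' = 1" "r'' i = k" "?F r''"
        using 1 step_prems dist n one by auto
      have "wp ?W (\<lambda>t r'' m''. I N r'' m'' \<and> ?F r'' \<and> t \<le> 1 + (N - Suc k) * (T + 3))
          (r''(i := Suc k, ''t'' := N - Suc k)) m''"
        by (rule Suc.hyps(1)) (use Suc.hyps(2) inv * dist in auto)
      moreover have "Suc (N - Suc k) = N - k" using step_hyps by simp
      then have "(N - k) * (T + 3) = (N - Suc k) * (T + 3) + (T + 3)"
        by (metis mult_Suc add.commute)
      ultimately show ?case using * dist 1 by (auto elim!: wp_mono)
    qed
  qed
  have "wp ?W (\<lambda>t r'' m''. I N r'' m'' \<and> ?F r'' \<and> t \<le> 1 + (N - 0) * (T + 3)) (r(i := 0, ''t'' := N)) m"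
    by (rule loop) (use ins[OF init] dist in auto)
  then show ?thesis unfolding For_def
    using n dist fin by (auto elim!: wp_mono)
qed

section \<open>Reachability and generating sets\<close>

lemma digits_exist:
  fixes B :: nat
  assumes "\<forall>d \<in> set ds. d < B"
  shows "\<exists>N < B ^ length ds. \<forall>j < length ds. N div B ^ j mod B = ds ! j"
  using assms
proof (induction ds)
  case (Cons d ds)
  then obtain N where N: "N < B ^ length ds" "\<forall>j < length ds. N div B ^ j mod B = ds ! j" by auto
  have d: "d < B" using Cons.prems by simp
  \<comment> \<open>Prepending the least significant digit \<open>d\<close> turns \<open>N\<close>
    into \<open>B * N + d\<close>. As \<open>N\<close> is below the power, \<open>Suc N\<close> is
    at most the power, which leaves room for \<open>d\<close>.\<close>
  have "B * N + d < B * Suc N" using d by simp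
  also have "\<dots> \<le> B * B ^ length ds" using N(1) by (intro mult_le_mono) auto
  finally have "B * N + d < B ^ length (d # ds)" by simp
  moreover have "(B * N + d) div B ^ j mod B = (d # ds) ! j" if "j < length (d # ds)" for j
  proof (cases j)
    case (Suc i)
    have "(B * N + d) div B ^ j = (B * N + d) div B div B ^ i"
      by (simp add: Suc div_mult2_eq)
    also have "(B * N + d) div B = N" using d by simp
    finally show ?thesis using N(2) that Suc by simp
  qed (use d in simp)
  ultimately show ?case by blast
qed simp

definition digits :: "nat \<Rightarrow> nat \<Rightarrow> nat \<Rightarrow> nat set" where
  "digits B k N = (\<lambda>j. N div B ^ j mod B) ` {..<k}"

text \<open>The digit \<open>n\<close> is a dummy, so that sets with fewer than \<open>k\<close> elements are covered.\<close>

lemma digits_enumerate: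
  "(\<exists>N < Suc n ^ k. P (digits (Suc n) k N \<inter> {..<n})) \<longleftrightarrow> (\<exists>S \<subseteq> {..<n}. card S \<le> k \<and> P S)"
proof
  assume "\<exists>N < Suc n ^ k. P (digits (Suc n) k N \<inter> {..<n})"
  then obtain N where N: "P (digits (Suc n) k N \<inter> {..<n})" by blast
  have "card (digits (Suc n) k N \<inter> {..<n}) \<le> card (digits (Suc n) k N)"
    by (intro card_mono) (auto simp: digits_def)
  also have "\<dots> \<le> k" unfolding digits_def using card_image_le[of "{..<k}"] by simp
  finally show "\<exists>S \<subseteq> {..<n}. card S \<le> k \<and> P S"
    using N by (intro exI[of _ "digits (Suc n) k N \<inter> {..<n}"]) simp
next
  assume "\<exists>S \<subseteq> {..<n}. card S \<le> k \<and> P S"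
  then obtain S where S: "S \<subseteq> {..<n}" "card S \<le> k" "P S" by blast
  obtain xs where xs: "set xs = S" "length xs = card S"
    using finite_distinct_list[OF finite_subset[OF S(1)]] distinct_card by fastforce
  define ds where "ds = xs @ replicate (k - card S) n"
  have len: "length ds = k" unfolding ds_def using xs S by simp
  have "\<forall>d \<in> set ds. d < Suc n" using S xs unfolding ds_def by auto
  from digits_exist[OF this] len obtain N
    where N: "N < Suc n ^ k" "\<forall>j < k. N div Suc n ^ j mod Suc n = ds ! j" by auto
  have "digits (Suc n) k N = set ds"
    unfolding digits_def using N(2) len by (simp add: set_conv_nth image_def) blast
  then have "digits (Suc n) k N \<inter> {..<n} = S"
    using S xs unfolding ds_def by auto
  then show "\<exists>N < Suc n ^ k. P (digits (Suc n) k N \<inter> {..<n})" using N(1) S(3) by metis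
qed

section \<open>Minimal generating sets\<close>

primrec prune :: "(nat \<times> nat) set \<Rightarrow> nat set \<Rightarrow> nat \<Rightarrow> nat set" where
  "prune E R 0 = R"
| "prune E R (Suc v) =
     (if E\<^sup>* `` (prune E R v - {v}) = R then prune E R v - {v} else prune E R v)"

lemma prune_subset: "prune E R v \<subseteq> R"
  by (induction v) auto

lemma prune_generates: "E\<^sup>* `` R = R \<Longrightarrow> E\<^sup>* `` prune E R v = R"
  by (induction v) auto

text \<open>A single pass suffices because generation is monotone: a node that was indispensable at
  its turn stays indispensable, as the set only shrinks afterwards.\<close>

lemma prune_minimal:
  assumes R: "E\<^sup>* `` R = R"
  shows "u < v \<Longrightarrow> u \<in> prune E R v \<Longrightarrow> E\<^sup>* `` (prune E R v - {u}) \<noteq> R"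
proof (induction v)
  case (Suc v)
  show ?case
  proof (cases "u < v")
    case True
    have "u \<in> prune E R v" using Suc.prems(2) by (auto split: if_splits)
    then have "E\<^sup>* `` (prune E R v - {u}) \<noteq> R" using Suc.IH True by blast
    moreover have "E\<^sup>* `` (prune E R (Suc v) - {u}) \<subseteq> E\<^sup>* `` (prune E R v - {u})"
      by (intro Image_mono) auto
    moreover have "E\<^sup>* `` (prune E R v - {u}) \<subseteq> E\<^sup>* `` R"
      using prune_subset[of E R v] by (intro Image_mono) auto
    ultimately show ?thesis using R by blast
  next
    case False
    then have "u = v" using Suc.prems by simp
    then show ?thesis using Suc.prems(2) by (auto split: if_splits)
  qed
qed simp

text \<open>Each element of an inclusion-minimal generating set is mutually reachable with an element of
  any other generating set, and distinct elements with distinct ones.\<close>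

lemma minimal_generators_card:
  assumes "finite Y" "E\<^sup>* `` X = E\<^sup>* `` Y"
    and min: "\<And>u. u \<in> X \<Longrightarrow> E\<^sup>* `` (X - {u}) \<noteq> E\<^sup>* `` X"
  shows "card X \<le> card Y"
proof -
  \<comment> \<open>If \<open>u\<close> reached a different element \<open>v\<close>, then
    \<open>v\<close> could be dropped without losing anything.\<close>
  have antichain: "u = v" if "u \<in> X" "v \<in> X" "(u, v) \<in> E\<^sup>*" for u v
  proof (rule ccontr)
    assume "u \<noteq> v"
    then have "E\<^sup>* `` X \<subseteq> E\<^sup>* `` (X - {v})" using that by (blast intro: rtrancl_trans)
    then show False using min[OF that(2)] by blast
  qed
  have "\<forall>x \<in> X. \<exists>y \<in> Y. (y, x) \<in> E\<^sup>*" using assms(2) by blast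
  then obtain f where f: "\<And>x. x \<in> X \<Longrightarrow> f x \<in> Y \<and> (f x, x) \<in> E\<^sup>*" by metis
  \<comment> \<open>Some \<open>x'\<close> in \<open>X\<close> reaches \<open>f x\<close> and
    through it \<open>x\<close>, so \<open>x' = x\<close> by the antichain property. If
    \<open>f x = f y\<close>, then \<open>x\<close> reaches \<open>y\<close> in the same way, which
    yields injectivity below.\<close>
  have forth: "(x, f x) \<in> E\<^sup>*" if "x \<in> X" for x
  proof -
    have "f x \<in> E\<^sup>* `` X" using f[OF that] assms(2) by blast
    then obtain x' where "x' \<in> X" "(x', f x) \<in> E\<^sup>*" by blast
    then show ?thesis using antichain f[OF that] that by (metis rtrancl_trans)
  qed
  have "inj_on f X" using f forth antichain by (metis inj_onI rtrancl_trans)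
  then show ?thesis using f assms(1) by (meson card_inj_on_le image_subsetI)
qed

lemma closure_subset:
  assumes "E \<subseteq> V \<times> V" "X \<subseteq> V"
  shows "E\<^sup>* `` X \<subseteq> V"
proof -
  have "y \<in> V" if "(x, y) \<in> E\<^sup>*" "x \<in> V" for x y
    using that by (induction rule: rtrancl_induct) (use assms in auto)
  then show ?thesis using assms by blast
qed

lemma rtrancl_Image_idem: "E\<^sup>* `` (E\<^sup>* `` X) = E\<^sup>* `` X"
  by (simp add: relcomp_Image[symmetric])

lemma sym_diff_cancel: "sym_diff A (sym_diff A S) = S"
  by blast

text \<open>\<open>sym_diff A\<close> is an involution, so error sets and active sets correspond one
  to one. The equation for \<open>prune\<close> also rejects every \<open>sym_diff A S\<close> that
  is not closed, because an image under \<open>E\<^sup>*\<close> is always closed. The pruned set is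
  itself the witness for the converse.\<close>

lemma guess_errors:
  assumes E: "E \<subseteq> {..<n} \<times> {..<n}" and A: "A \<subseteq> {..<n}"
  shows "(\<exists>X \<subseteq> {..<n}. card X \<le> b \<and> card (sym_diff A (E\<^sup>* `` X)) \<le> c) \<longleftrightarrow>
    (\<exists>S \<subseteq> {..<n}. card S \<le> c \<and> E\<^sup>* `` prune E (sym_diff A S) n = sym_diff A S \<and>
      card (prune E (sym_diff A S) n) \<le> b)"
proof
  assume "\<exists>X \<subseteq> {..<n}. card X \<le> b \<and> card (sym_diff A (E\<^sup>* `` X)) \<le> c"
  then obtain X where X: "X \<subseteq> {..<n}" "card X \<le> b" "card (sym_diff A (E\<^sup>* `` X)) \<le> c" by blast
  define R where "R = E\<^sup>* `` X"
  have R: "R \<subseteq> {..<n}" unfolding R_def by (rule closure_subset[OF E X(1)])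
  have closed: "E\<^sup>* `` R = R" unfolding R_def by (rule rtrancl_Image_idem)
  have "card (prune E R n) \<le> card X"
  proof (rule minimal_generators_card)
    show "E\<^sup>* `` prune E R n = E\<^sup>* `` X"
      using prune_generates[OF closed] unfolding R_def .
    show "E\<^sup>* `` (prune E R n - {u}) \<noteq> E\<^sup>* `` prune E R n" if "u \<in> prune E R n" for u
      using prune_minimal[OF closed, of u n] prune_generates[OF closed] that R prune_subset[of E R n] by auto
    show "finite X" using X(1) finite_subset by blast
  qed
  moreover have "sym_diff A R \<subseteq> {..<n}" using A R by blast
  ultimately show "\<exists>S \<subseteq> {..<n}. card S \<le> c \<and> E\<^sup>* `` prune E (sym_diff A S) n = sym_diff A S \<and>
      card (prune E (sym_diff A S) n) \<le> b"
    using X R_def prune_generates[OF closed]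
    by (intro exI[of _ "sym_diff A R"]) (simp add: sym_diff_cancel)
next
  assume "\<exists>S \<subseteq> {..<n}. card S \<le> c \<and> E\<^sup>* `` prune E (sym_diff A S) n = sym_diff A S \<and>
      card (prune E (sym_diff A S) n) \<le> b"
  then obtain S where S: "S \<subseteq> {..<n}" "card S \<le> c"
    "E\<^sup>* `` prune E (sym_diff A S) n = sym_diff A S" "card (prune E (sym_diff A S) n) \<le> b" by blast
  have "prune E (sym_diff A S) n \<subseteq> {..<n}" using prune_subset A S(1) by blast
  then show "\<exists>X \<subseteq> {..<n}. card X \<le> b \<and> card (sym_diff A (E\<^sup>* `` X)) \<le> c"
    using S by (intro exI[of _ "prune E (sym_diff A S) n"]) (simp add: sym_diff_cancel)
qed

text \<open>Because \<open>Y\<close> is chosen inside \<open>X\<close>, its size is bounded by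
  \<open>card A\<close> and by \<open>card X\<close> at once. This allows one program to serve both
  parameters.\<close>

lemma few_effectors:
  assumes A: "finite A" and X: "finite X"
  shows "\<exists>Y \<subseteq> X. card Y \<le> card A \<and> card Y \<le> card X \<and>
    sym_diff A (E\<^sup>* `` Y) \<subseteq> sym_diff A (E\<^sup>* `` X)"
proof -
  have "\<forall>v \<in> A \<inter> E\<^sup>* `` X. \<exists>x. x \<in> X \<and> (x, v) \<in> E\<^sup>*" by blast
  from bchoice[OF this] obtain f
    where f: "\<And>v. v \<in> A \<inter> E\<^sup>* `` X \<Longrightarrow> f v \<in> X \<and> (f v, v) \<in> E\<^sup>*" by blast
  define Y where "Y = f ` (A \<inter> E\<^sup>* `` X)"
  have sub: "Y \<subseteq> X" using f unfolding Y_def by blast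
  have "card Y \<le> card (A \<inter> E\<^sup>* `` X)" unfolding Y_def by (rule card_image_le) (use A in simp)
  also have "\<dots> \<le> card A" by (rule card_mono) (use A in auto)
  finally have "card Y \<le> card A" .
  moreover have "card Y \<le> card X" by (rule card_mono[OF X sub])
  moreover have "A \<inter> E\<^sup>* `` X \<subseteq> E\<^sup>* `` Y" using f unfolding Y_def by blast
  then have "sym_diff A (E\<^sup>* `` Y) \<subseteq> sym_diff A (E\<^sup>* `` X)" using sub by blast
  ultimately show ?thesis using sub by blast
qed

section \<open>Arrays in memory\<close>

text \<open>The rule for composing subprograms: the continuation receives the result of
  \<open>P\<close> together with the fact that all registers outside \<open>written P\<close> kept
  their values.\<close>

lemma wp_use:
  assumes "wp P Q r m"
    and "\<And>t r' m'. Q t r' m' \<Longrightarrow> \<forall>x. x \<notin> written P \<longrightarrow> r' x = r x \<Longrightarrow> Q' t r' m'"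
  shows "wp P Q' r m"
  using wp_mono[OF wp_written[OF assms(1)]] assms(2) by blast

definition aset :: "(nat \<Rightarrow> nat) \<Rightarrow> nat \<Rightarrow> nat \<Rightarrow> nat set" where
  "aset m b n = {i. i < n \<and> m (b + i) \<noteq> 0}"

definition arel :: "(nat \<Rightarrow> nat) \<Rightarrow> nat \<Rightarrow> nat \<Rightarrow> (nat \<times> nat) set" where
  "arel m b n = {(i, j). i < n \<and> j < n \<and> m (b + n * i + j) \<noteq> 0}"

abbreviation outside :: "nat \<Rightarrow> nat \<Rightarrow> (nat \<Rightarrow> nat) \<Rightarrow> (nat \<Rightarrow> nat) \<Rightarrow> bool" where
  "outside b n m m' \<equiv> \<forall>a. a < b \<or> b + n \<le> a \<longrightarrow> m' a = m a"

lemma aset_subset: "aset m b n \<subseteq> {..<n}"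
  by (auto simp: aset_def)

lemma finite_aset [simp]: "finite (aset m b n)"
  by (simp add: aset_def)

lemma notin_aset [simp]: "k \<notin> aset m b k"
  by (simp add: aset_def)

lemma aset_Suc: "aset m b (Suc k) = (if m (b + k) = 0 then aset m b k else insert k (aset m b k))"
  by (auto simp: aset_def less_Suc_eq)

lemma aset_cong: "(\<And>i. i < n \<Longrightarrow> m' (b + i) = m (b + i)) \<Longrightarrow> aset m' b n = aset m b n"
  by (auto simp: aset_def)

text \<open>The common invariant step of the loops that write cell \<open>c + k\<close> in round
  \<open>k\<close>; \<open>P\<close> describes the final content of a cell in terms of its
  index.\<close>

lemma fill_step:
  assumes "\<forall>i < k. P i (m' (c + i))" "P k (v :: nat)" "outside c n m m'" "k < n"
  shows "(\<forall>i < Suc k. P i ((m'(c + k := v)) (c + i))) \<and> outside c n m (m'(c + k := v))"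
  using assms by (simp add: less_Suc_eq)

text \<open>The loop bound is \<open>''B''\<close>, that is \<open>n + 1\<close>, and not
  \<open>''n''\<close>: decoding may also mark the cell of the dummy digit \<open>n\<close>.\<close>

definition Clear :: "reg \<Rightarrow> com" where
  "Clear a = For ''i'' ''B'' (Add ''j'' a ''i'' ;; Const ''f'' 0 ;; Store ''j'' ''f'')"

lemma written_Clear [simp]: "written (Clear a) = {''i'', ''t'', ''j'', ''f''}"
  by (auto simp: Clear_def)

lemma wp_Clear:
  assumes "r ''B'' = B" "r ''1'' = 1" "a \<notin> {''i'', ''t'', ''j'', ''f''}"
  shows "wp (Clear a) (\<lambda>t r' m'. t \<le> 3 + 6 * B \<and>
    (\<forall>i < B. m' (r a + i) = 0) \<and> outside (r a) B m m') r m"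
  unfolding Clear_def
proof (rule wp_For[where N = B and T = 3 and
      I = "\<lambda>k r' m'. (\<forall>i < k. m' (r a + i) = 0) \<and> outside (r a) B m m'"], goal_cases)
  case (11 k r' m')
  note step = fill_step[where P = "\<lambda>i v. v = 0"]
  show ?case using assms 11(3,4) 11(2) step[of k m' "r a" 0 B m] 11(1) by simp
qed (use assms in simp_all)

definition Count :: "reg \<Rightarrow> com" where
  "Count a = Const ''K'' 0 ;; For ''i'' ''n''
     (Add ''j'' a ''i'' ;; Load ''j'' ''j'' ;; IfNZ ''j'' (Add ''K'' ''K'' ''1'') Skip)"

lemma written_Count [simp]: "written (Count a) = {''K'', ''i'', ''t'', ''j''}"
  by (auto simp: Count_def)

lemma wp_Count:
  assumes "r ''n'' = n" "r ''1'' = 1" "a \<notin> {''K'', ''i'', ''t'', ''j''}"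
  shows "wp (Count a) (\<lambda>t r' m'. t \<le> 4 + 7 * n \<and>
    r' ''K'' = card (aset m (r a) n) \<and> m' = m) r m"
  unfolding Count_def wp_Seq wp_basic
proof (rule wp_For[where N = n and T = 4 and
      I = "\<lambda>k r' m'. r' ''K'' = card (aset m (r a) k) \<and> m' = m"], goal_cases)
  case (11 k r' m')
  then show ?case using assms by (simp add: aset_Suc)
next
  case 10
  then show ?case using assms by (simp add: aset_def)
qed (use assms in simp_all)

text \<open>Besides symmetric differences this routine provides copying, with an empty second
  operand, and equality tests, when followed by \<open>Count\<close>.\<close>

definition Xor :: "reg \<Rightarrow> reg \<Rightarrow> reg \<Rightarrow> com" where
  "Xor a b c = For ''i'' ''n''
     (Add ''j'' a ''i'' ;; Load ''f'' ''j'' ;; Add ''j'' b ''i'' ;; Load ''h'' ''j'' ;;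
      IfNZ ''f'' (IfNZ ''h'' (Const ''h'' 0) (Const ''h'' 1)) Skip ;;
      Add ''j'' c ''i'' ;; Store ''j'' ''h'')"

lemma written_Xor [simp]: "written (Xor a b c) = {''i'', ''t'', ''j'', ''f'', ''h''}"
  by (auto simp: Xor_def)

lemma wp_Xor:
  fixes m :: "nat \<Rightarrow> nat"
  assumes "r ''n'' = n" "r ''1'' = 1"
    and "a \<notin> {''i'', ''t'', ''j'', ''f'', ''h''}" "b \<notin> {''i'', ''t'', ''j'', ''f'', ''h''}"
    and "c \<notin> {''i'', ''t'', ''j'', ''f'', ''h''}"
    and "r a + n \<le> r c \<or> r c + n \<le> r a" "r b + n \<le> r c \<or> r c + n \<le> r b"
  shows "wp (Xor a b c) (\<lambda>t r' m'. t \<le> 3 + 12 * n \<and>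
    aset m' (r c) n = sym_diff (aset m (r a) n) (aset m (r b) n) \<and> outside (r c) n m m') r m"
proof -
  define P where "P = (\<lambda>i v. (v :: nat) \<noteq> 0 \<longleftrightarrow> (m (r a + i) \<noteq> 0) \<noteq> (m (r b + i) \<noteq> 0))"
  define J where "J = (\<lambda>k m'. (\<forall>i < k. P i (m' (r c + i))) \<and> outside (r c) n m m')"
  have Jstep: "J (Suc k) (m'(r c + k := v))"
    if "J k m'" "k < n" "v \<noteq> 0 \<longleftrightarrow> (m (r a + k) \<noteq> 0) \<noteq> (m (r b + k) \<noteq> 0)" for k m' v
    using fill_step[of k P m' "r c" v] that unfolding J_def P_def by blast
  \<comment> \<open>The output array overlaps neither input array, so the cells read in round
    \<open>k\<close> still have their original values.\<close>
  have Jread: "m' (r a + k) = m (r a + k)" "m' (r b + k) = m (r b + k)"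
    if "J k m'" "k < n" for k m'
  proof -
    have "r a + k < r c \<or> r c + n \<le> r a + k" "r b + k < r c \<or> r c + n \<le> r b + k"
      using assms(6,7) that(2) by linarith+
    then show "m' (r a + k) = m (r a + k)" "m' (r b + k) = m (r b + k)"
      using that(1) unfolding J_def by blast+
  qed
  have J0: "J 0 m" unfolding J_def by simp
  show ?thesis
    unfolding Xor_def
  proof (rule wp_For[where N = n and T = 9 and I = "\<lambda>k r' m'. J k m'"], goal_cases)
    case (11 k r' m')
    have r': "r' ''i'' = k" "r' a = r a" "r' b = r b" "r' c = r c"
      using 11(3,4) assms by simp_all
    show ?case
      using assms(3-5) Jstep[OF 11(2,1)] by (simp add: r' Jread[OF 11(2,1)])
  next
    case (13 t r' m')
    have P: "m' (r c + i) \<noteq> 0 \<longleftrightarrow> (m (r a + i) \<noteq> 0) \<noteq> (m (r b + i) \<noteq> 0)" if "i < n" for i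
      using 13(1) that unfolding J_def P_def by blast
    have "aset m' (r c) n = sym_diff (aset m (r a) n) (aset m (r b) n)"
      using P unfolding aset_def by blast
    then show ?case using 13 unfolding J_def by simp
  qed (use assms J0 in simp_all)
qed

section \<open>Reachability by repeated relaxation of all arcs\<close>

definition Relax :: "reg \<Rightarrow> com" where
  "Relax y = Copy ''q'' ''e'' ;; For ''i'' ''n'' (Add ''j'' y ''i'' ;; Load ''f'' ''j'' ;;
     For ''j'' ''n'' (Load ''h'' ''q'' ;;
       IfNZ ''f'' (IfNZ ''h'' (Add ''h'' y ''j'' ;; Store ''h'' ''1'') Skip) Skip ;;
       Add ''q'' ''q'' ''1''))"

lemma written_Relax [simp]: "written (Relax y) = {''q'', ''i'', ''t'', ''j'', ''f'', ''h''}"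
  by (auto simp: Relax_def)

text \<open>The set is updated in place, so a node activated during the pass already spreads in it
  if its row comes later. Hence the result is only bracketed between one step and the full closure.
  In place of the product \<open>n * i\<close>, a pointer \<open>''q''\<close> walks through the
  matrix cell by cell.\<close>

lemma wp_Relax:
  fixes m :: "nat \<Rightarrow> nat"
  assumes "r ''n'' = n" "r ''1'' = 1" "r ''e'' = e"
    and "y \<notin> {''q'', ''i'', ''t'', ''j'', ''f'', ''h''}"
    and "e + n * n \<le> r y"
  defines "S \<equiv> aset m (r y) n" and "E \<equiv> arel m e n"
  shows "wp (Relax y) (\<lambda>t r' m'. t \<le> 4 + n * (9 * n + 8) \<and>
    S \<union> E `` S \<subseteq> aset m' (r y) n \<and> aset m' (r y) n \<subseteq> E\<^sup>* `` S \<and> outside (r y) n m m') r m"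
proof -
  define J where "J = (\<lambda>m'. S \<subseteq> aset m' (r y) n \<and> aset m' (r y) n \<subseteq> E\<^sup>* `` S \<and> outside (r y) n m m')"
  \<comment> \<open>\<open>D\<close> and \<open>D'\<close> record the arcs already handled, in
    complete rows and in the current row. They refer to the initial set \<open>S\<close>, so they
    survive later additions to the array.\<close>
  define D where "D = (\<lambda>k m'. \<forall>(i, j) \<in> E. i < k \<and> i \<in> S \<longrightarrow> j \<in> aset m' (r y) n)"
  define D' where "D' = (\<lambda>k l m'. \<forall>j < l. (k, j) \<in> E \<and> k \<in> S \<longrightarrow> j \<in> aset m' (r y) n)"
  have JD: "J m \<and> D 0 m" by (auto simp: J_def D_def S_def)
  have mE: "m' (e + n * k + l) = m (e + n * k + l)" if "J m'" "k < n" "l < n" for m' k l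
  proof -
    have "n * k + l < n * Suc k" using that by simp
    also have "\<dots> \<le> n * n" using that by (intro mult_le_mono) auto
    finally show ?thesis using that(1) assms(5) unfolding J_def by simp
  qed
  have ynot: "y \<noteq> ''q''" "y \<noteq> ''i''" "y \<noteq> ''t''" "y \<noteq> ''j''" "y \<noteq> ''f''" "y \<noteq> ''h''"
    using assms(4) by auto
  show ?thesis
    unfolding Relax_def wp_Seq wp_basic
  proof (rule wp_For[where N = n and T = "9 * n + 5" and
        I = "\<lambda>k r' m'. r' ''q'' = e + n * k \<and> J m' \<and> D k m'"], goal_cases)
    case (11 k r' m')
    have r': "r' ''n'' = n" "r' ''1'' = 1" "r' y = r y" "r' ''i'' = k"
      using 11(4) assms(1-4) ynot 11(3) by simp_all
    have Jm: "J m'" using 11(2) by blast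
    show ?case
      unfolding wp_Seq wp_basic
    proof (rule wp_For[where N = n and T = 6 and
        I = "\<lambda>l r'' m''. r'' ''q'' = e + n * k + l \<and> J m'' \<and> D k m'' \<and> D' k l m'' \<and>
          r'' ''f'' = m' (r y + k)"], goal_cases)
      case (11 l r'' m'')
      have r'': "r'' ''n'' = n" "r'' ''1'' = 1" "r'' y = r y" "r'' ''j'' = l"
        using 11(4) r' ynot 11(3) by simp_all
      have k: "k < n" and l: "l < n" by fact+
      have f: "k \<in> S \<Longrightarrow> m' (r y + k) \<noteq> 0" "m' (r y + k) \<noteq> 0 \<Longrightarrow> k \<in> E\<^sup>* `` S"
        using Jm k unfolding J_def by (auto simp: aset_def)
      have I: "J m''" "D k m''" "D' k l m''" "r'' ''q'' = e + n * k + l" "r'' ''f'' = m' (r y + k)"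
        using 11(2) by blast+
      have h: "m'' (e + n * k + l) \<noteq> 0 \<longleftrightarrow> (k, l) \<in> E"
        using mE[OF I(1) k l] k l unfolding E_def arel_def by simp
      have upd: "aset (m''(r y + l := Suc 0)) (r y) n = insert l (aset m'' (r y) n)"
        using l by (auto simp: aset_def)
      have J': "J (m''(r y + l := Suc 0))" if "m' (r y + k) \<noteq> 0" "(k, l) \<in> E"
      proof -
        have "l \<in> E\<^sup>* `` S" using f(2)[OF that(1)] that(2) by (auto intro: rtrancl_into_rtrancl)
        then show ?thesis using I(1) l unfolding J_def upd by auto
      qed
      have D1: "D k (m''(r y + l := Suc 0))" "D' k (Suc l) (m''(r y + l := Suc 0))"
        using I(2,3) by (auto simp: D_def D'_def upd less_Suc_eq)
      have D2: "D' k (Suc l) m''" if "m' (r y + k) = 0 \<or> (k, l) \<notin> E"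
        using I(3) that f(1) by (auto simp: D'_def less_Suc_eq)
      show ?case
        using J' D1 D2 I h r'' ynot by simp
    next
      case (13 t r'' m'')
      have "D k m''" "D' k n m''" using 13(1) by blast+
      moreover have "j < n" if "(i, j) \<in> E" for i j using that by (simp add: E_def arel_def)
      ultimately have "D (Suc k) m''" unfolding D_def D'_def by (auto simp: less_Suc_eq)
      then show ?case using 13 by simp
    next
      case 10
      then show ?case using 11 r' ynot by (simp add: D'_def)
    qed (use r' ynot in simp_all)
  next
    case (13 t r' m')
    then have "J m'" "D n m'" by blast+
    moreover have "i < n" if "(i, j) \<in> E" for i j using that by (simp add: E_def arel_def)
    ultimately have "E `` S \<subseteq> aset m' (r y) n" unfolding D_def by blast
    then show ?case using 13(3) \<open>J m'\<close> unfolding J_def by (simp add: add.commute)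
  next
    case 10
    then show ?case using assms JD by simp
  qed (use assms ynot in simp_all)
qed

text \<open>The number of rounds comes from \<open>rtrancl_finite_eq_relpow\<close>: every reachable
  node is reached in at most as many steps as there are arcs, and there are at most
  \<open>n * n\<close> of them.\<close>

definition Closure :: "reg \<Rightarrow> com" where
  "Closure y = For ''s'' ''N'' (Relax y)"

lemma written_Closure [simp]:
  "written (Closure y) = {''s'', ''q'', ''i'', ''t'', ''j'', ''f'', ''h''}"
  by (auto simp: Closure_def)

lemma arel_cong: "(\<And>a. a < b + n * n \<Longrightarrow> m' a = m a) \<Longrightarrow> arel m' b n = arel m b n"
proof -
  assume *: "\<And>a. a < b + n * n \<Longrightarrow> m' a = m a"
  have "m' (b + n * i + j) = m (b + n * i + j)" if "i < n" "j < n" for i j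
  proof -
    have "n * i + j < n * Suc i" using that by simp
    also have "\<dots> \<le> n * n" using that by (intro mult_le_mono) auto
    finally show ?thesis using * by simp
  qed
  then show ?thesis by (auto simp: arel_def)
qed

lemma arel_subset: "arel m e n \<subseteq> {..<n} \<times> {..<n}"
  by (auto simp: arel_def)

lemma card_arel: "finite (arel m e n)" "card (arel m e n) \<le> n * n"
  using arel_subset[of m e n] card_mono[OF _ arel_subset[of m e n]] finite_subset by auto

lemma wp_Closure:
  fixes m :: "nat \<Rightarrow> nat"
  assumes "r ''n'' = n" "r ''N'' = n * n" "r ''1'' = 1" "r ''e'' = e"
    and "y \<notin> {''s'', ''q'', ''i'', ''t'', ''j'', ''f'', ''h''}"
    and "e + n * n \<le> r y"
  defines "S \<equiv> aset m (r y) n" and "E \<equiv> arel m e n"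
  shows "wp (Closure y) (\<lambda>t r' m'. t \<le> 3 + n * n * (4 + n * (9 * n + 8) + 3) \<and>
    aset m' (r y) n = E\<^sup>* `` S \<and> outside (r y) n m m') r m"
proof -
  define J where "J = (\<lambda>k m'. (\<forall>j \<le> k. (E ^^ j) `` S \<subseteq> aset m' (r y) n) \<and>
    aset m' (r y) n \<subseteq> E\<^sup>* `` S \<and> outside (r y) n m m')"
  have J0: "J 0 m" unfolding J_def S_def by auto
  have Jarel: "arel m' e n = E" if "J k m'" for k m'
  proof -
    have "m' a = m a" if "a < e + n * n" for a
      using \<open>J k m'\<close> that assms(6) unfolding J_def by simp
    then show ?thesis unfolding E_def by (rule arel_cong)
  qed
  have Jstep: "J (Suc k) m''"
    if "J k m'" "aset m' (r y) n \<union> E `` aset m' (r y) n \<subseteq> aset m'' (r y) n"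
      "aset m'' (r y) n \<subseteq> E\<^sup>* `` aset m' (r y) n" "outside (r y) n m' m''" for k m' m''
  proof -
    have "(E ^^ j) `` S \<subseteq> aset m'' (r y) n" if "j \<le> Suc k" for j
    proof (cases "j = Suc k")
      case True
      have "(E ^^ k) `` S \<subseteq> aset m' (r y) n" using \<open>J k m'\<close> unfolding J_def by blast
      then have "E `` (E ^^ k) `` S \<subseteq> aset m'' (r y) n" using that(1) \<open>_ \<subseteq> aset m'' _ _\<close> by blast
      then show ?thesis using True by (simp add: relcomp_Image)
    next
      case False
      then have "j \<le> k" using that by simp
      then have "(E ^^ j) `` S \<subseteq> aset m' (r y) n" using \<open>J k m'\<close> unfolding J_def by blast
      then show ?thesis using \<open>_ \<subseteq> aset m'' _ _\<close> by blast
    qed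
    moreover have "aset m'' (r y) n \<subseteq> E\<^sup>* `` (E\<^sup>* `` S)"
      using that(1,3) unfolding J_def by blast
    moreover have "outside (r y) n m m''" using that(1,4) unfolding J_def by simp
    ultimately show ?thesis unfolding J_def rtrancl_Image_idem by blast
  qed
  show ?thesis
    unfolding Closure_def
  proof (rule wp_For[where N = "n * n" and T = "4 + n * (9 * n + 8)" and I = "\<lambda>k r' m'. J k m'"],
      goal_cases)
    case (11 k r' m')
    have r': "r' ''n'' = n" "r' ''1'' = 1" "r' ''e'' = e" "r' y = r y"
      using 11(4) assms by simp_all
    show ?case
    proof (rule wp_mono[OF wp_Relax[OF r'(1-3)]], goal_cases)
      case (3 t r'' m'')
      then show ?case using Jstep[OF 11(2)] unfolding r' Jarel[OF 11(2)] by blast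
    qed (use assms r' in simp_all)
  next
    case (13 t r' m')
    have "E\<^sup>* `` S \<subseteq> aset m' (r y) n"
    proof
      fix v assume "v \<in> E\<^sup>* `` S"
      then obtain u j where "u \<in> S" "(u, v) \<in> E ^^ j" "j \<le> card E"
        using rtrancl_finite_eq_relpow[OF card_arel(1)[of m e n]] unfolding E_def by auto
      then show "v \<in> aset m' (r y) n"
        using 13(1) card_arel(2)[of m e n] unfolding J_def E_def by (meson Image_iff le_trans subsetD)
    qed
    then have "aset m' (r y) n = E\<^sup>* `` S" using 13(1) unfolding J_def by blast
    then show ?case using 13 unfolding J_def by blast
  qed (use assms J0 in simp_all)
qed

section \<open>Decoding the self-delimiting binary numbers\<close>

definition input :: "bool list \<Rightarrow> (nat \<Rightarrow> nat) \<Rightarrow> bool" where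
  "input xs m \<longleftrightarrow> (\<forall>i < length xs. m i = of_bool (xs ! i))"

lemma input_Cons:
  assumes "input xs m" "drop p xs = b # ys"
  shows "m p = of_bool b" "drop (Suc p) xs = ys" "p < length xs"
proof -
  show p: "p < length xs" using assms(2) by (metis drop_all list.distinct(1) not_le)
  then show "m p = of_bool b" using assms by (metis input_def nth_via_drop)
  show "drop (Suc p) xs = ys" using assms(2) by (metis drop_Suc list.sel(3) tl_drop)
qed

definition ReadNat :: "reg \<Rightarrow> com" where
  "ReadNat x = Const x 0 ;; Const ''w'' 1 ;; Load ''c'' ''p'' ;;
     WhileNZ ''c'' (Add ''p'' ''p'' ''1'' ;; Load ''c'' ''p'' ;;
       IfNZ ''c'' (Add x x ''w'') Skip ;; Add ''w'' ''w'' ''w'' ;;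
       Add ''p'' ''p'' ''1'' ;; Load ''c'' ''p'') ;;
     Add ''p'' ''p'' ''1''"

lemma written_ReadNat [simp]: "written (ReadNat x) = {x, ''w'', ''c'', ''t'', ''p''}"
  by (auto simp: ReadNat_def)

lemma encode_nat_0: "encode_nat 0 = [False]"
  by (simp add: encode_nat_def binary.simps)

lemma encode_nat_pos: "v \<noteq> 0 \<Longrightarrow> encode_nat v = True # odd v # encode_nat (v div 2)"
  by (subst encode_nat_def, subst binary.simps) (simp add: encode_nat_def)

lemma length_encode_nat: "1 \<le> length (encode_nat v)"
  by (simp add: encode_nat_def)

text \<open>The accumulator and the weight \<open>''w''\<close> of the next digit are arbitrary,
  which makes the induction from \<open>v div 2\<close> to \<open>v\<close> possible. A round takes
  8 steps and consumes 2 bits, hence the factor 4. The loop stops on the closing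
  \<open>False\<close>, so the pointer is one short of \<open>ys\<close>.\<close>

lemma wp_ReadNat_loop:
  assumes "input xs m" "x \<notin> {''w'', ''c'', ''t'', ''p'', ''1''}"
  shows "drop (r ''p'') xs = encode_nat v @ ys \<Longrightarrow> r ''c'' = m (r ''p'') \<Longrightarrow> r ''1'' = 1 \<Longrightarrow>
    wp (WhileNZ ''c'' (Add ''p'' ''p'' ''1'' ;; Load ''c'' ''p'' ;;
       IfNZ ''c'' (Add x x ''w'') Skip ;; Add ''w'' ''w'' ''w'' ;;
       Add ''p'' ''p'' ''1'' ;; Load ''c'' ''p''))
     (\<lambda>t r' m'. t \<le> 4 * length (encode_nat v) \<and> m' = m \<and> r' x = r x + r ''w'' * v \<and>
        drop (Suc (r' ''p'')) xs = ys \<and> r' ''1'' = 1) r m"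
proof (induction v arbitrary: r rule: less_induct)
  case (less v)
  show ?case
  proof (cases "v = 0")
    case True
    note * = input_Cons[OF assms(1) less.prems(1)[unfolded True encode_nat_0, simplified]]
    show ?thesis by (subst wp_WhileNZ) (use * True less.prems in \<open>simp add: encode_nat_0\<close>)
  next
    case False
    note h1 = input_Cons[OF assms(1) less.prems(1)[unfolded encode_nat_pos[OF False], simplified]]
    note h2 = input_Cons[OF assms(1) h1(2)]
    have x: "x \<noteq> ''w''" "x \<noteq> ''c''" "x \<noteq> ''t''" "x \<noteq> ''p''" "x \<noteq> ''1''"
      "''w'' \<noteq> x" "''c'' \<noteq> x" "''t'' \<noteq> x" "''p'' \<noteq> x" "''1'' \<noteq> x"
      using assms(2) by auto
    have v: "v = 2 * (v div 2) + of_bool (odd v)" by simp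
    have IH: "wp (WhileNZ ''c'' (Add ''p'' ''p'' ''1'' ;; Load ''c'' ''p'' ;;
         IfNZ ''c'' (Add x x ''w'') Skip ;; Add ''w'' ''w'' ''w'' ;;
         Add ''p'' ''p'' ''1'' ;; Load ''c'' ''p''))
       (\<lambda>t r' m'. t \<le> 4 * length (encode_nat (v div 2)) \<and> m' = m \<and> r' x = s x + s ''w'' * (v div 2) \<and>
          drop (Suc (r' ''p'')) xs = ys \<and> r' ''1'' = 1) s m"
      if "s ''p'' = Suc (Suc (r ''p''))" "s ''c'' = m (s ''p'')" "s ''1'' = 1" for s
      by (rule less.IH) (use False that h2 in simp_all)
    have len: "length (encode_nat v) = length (encode_nat (v div 2)) + 2"
      using encode_nat_pos[OF False] by simp
    show ?thesis
    proof (cases "odd v")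
      case True
      then have v: "v = Suc (2 * (v div 2))" by simp
      show ?thesis
        apply (subst wp_WhileNZ)
        apply (simp add: h1 h2 less.prems True x)
        apply (rule wp_mono[OF IH])
           apply (simp_all add: x less.prems len)
        apply (subst (2) v)
        apply simp
        done
    next
      case False
      then have v: "v = 2 * (v div 2)" by simp
      show ?thesis
        apply (subst wp_WhileNZ)
        apply (simp add: h1 h2 less.prems False x)
        apply (rule wp_mono[OF IH])
           apply (simp_all add: x less.prems len)
        apply (subst (2) v)
        apply simp
        done
    qed
  qed
qed

lemma wp_ReadNat:
  assumes "input xs m" "x \<notin> {''w'', ''c'', ''t'', ''p'', ''1''}"
    and "drop (r ''p'') xs = encode_nat v @ ys" "r ''1'' = 1"
  shows "wp (ReadNat x) (\<lambda>t r' m'. t \<le> 8 * length (encode_nat v) \<and> m' = m \<and> r' x = v \<and>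
    drop (r' ''p'') xs = ys) r m"
proof -
  have x: "x \<noteq> ''w''" "x \<noteq> ''c''" "x \<noteq> ''t''" "x \<noteq> ''p''" "x \<noteq> ''1''"
    "''w'' \<noteq> x" "''c'' \<noteq> x" "''t'' \<noteq> x" "''p'' \<noteq> x" "''1'' \<noteq> x"
    using assms(2) by auto
  show ?thesis
    unfolding ReadNat_def wp_Seq wp_basic
    by (rule wp_mono[OF wp_ReadNat_loop[OF assms(1,2)]])
      (use assms(3,4) x length_encode_nat[of v] in auto)
qed

section \<open>Enumerating small sets\<close>

text \<open>Division by counting to \<open>''q''\<close>: \<open>''s''\<close> is a counter that
  wraps around at \<open>''B''\<close>, and \<open>''h''\<close> counts the wraps. The time is
  linear in the value of \<open>''q''\<close>.\<close>

definition DivMod :: com where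
  "DivMod = Const ''s'' 0 ;; Const ''h'' 0 ;; For ''j'' ''q''
     (Add ''s'' ''s'' ''1'' ;; Sub ''c'' ''B'' ''s'' ;;
      IfNZ ''c'' Skip (Const ''s'' 0 ;; Add ''h'' ''h'' ''1''))"

lemma written_DivMod [simp]: "written DivMod = {''s'', ''h'', ''j'', ''t'', ''c''}"
  by (auto simp: DivMod_def)

lemma wp_DivMod:
  assumes "r ''1'' = 1" "r ''B'' = B" "0 < B" "r ''q'' = q"
  shows "wp DivMod (\<lambda>t r' m'. t \<le> 5 + q * 8 \<and> m' = m \<and> r' ''s'' = q mod B \<and> r' ''h'' = q div B) r m"
  unfolding DivMod_def wp_Seq wp_basic
proof (rule wp_For[where N = q and T = 5 and
      I = "\<lambda>l r' m'. r' ''s'' = l mod B \<and> r' ''h'' = l div B \<and> m' = m"], goal_cases)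
  case (11 l r' m')
  then show ?case using assms
    by (simp add: mod_Suc div_Suc not_le) (metis Suc_lessI mod_less_divisor)
qed (use assms in simp_all)

definition Decode :: com where
  "Decode = Copy ''q'' ''o'' ;; For ''i'' ''k''
     (DivMod ;; Add ''s'' ''s'' ''d'' ;; Store ''s'' ''1'' ;; Copy ''q'' ''h'')"

lemma written_Decode [simp]:
  "written Decode = {''q'', ''i'', ''t'', ''s'', ''h'', ''j'', ''c''}"
  by (auto simp: Decode_def)

lemma digits_Suc: "digits B (Suc k) N = insert (N div B ^ k mod B) (digits B k N)"
  by (simp add: digits_def lessThan_Suc)

lemma wp_Decode:
  assumes r: "r ''1'' = 1" "r ''B'' = B" "r ''k'' = k" "r ''o'' = N" "r ''d'' = d"
    and "0 < B" "\<forall>i < B. m (d + i) = 0"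
  shows "wp Decode (\<lambda>t r' m'. t \<le> 4 + k * (8 * N + 11) \<and>
    aset m' d B = digits B k N \<and> outside d B m m') r m"
proof -
  define J where "J = (\<lambda>i m'. aset m' d B = digits B i N \<and> outside d B m m')"
  have J0: "J 0 m" using assms(7) by (simp add: J_def aset_def digits_def)
  have Jstep: "J (Suc i) (m'(d + N div B ^ i mod B := Suc 0))" if "J i m'" for i m'
  proof -
    have "N div B ^ i mod B < B" using assms(6) by simp
    then show ?thesis using that unfolding J_def digits_Suc by (auto simp: aset_def)
  qed
  show ?thesis
    unfolding Decode_def wp_Seq[of "Copy _ _"] wp_basic
  proof (rule wp_For[where N = k and T = "8 * N + 8" and
        I = "\<lambda>i r' m'. r' ''q'' = N div B ^ i \<and> J i m'"], goal_cases)
    case (11 i r' m')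
    have r': "r' ''1'' = 1" "r' ''B'' = B" "r' ''q'' = N div B ^ i" "r' ''d'' = d"
      using 11(2,4) r by simp_all
    have J: "J i m'" using 11(2) by blast
    have le: "N div B ^ i \<le> N" by simp
    have dv: "N div B ^ i div B = N div B ^ Suc i" by (simp only: power_Suc2 div_mult2_eq)
    show ?case
      unfolding wp_Seq[of DivMod]
    proof (rule wp_use[OF wp_DivMod[OF r'(1,2) assms(6) r'(3)]], goal_cases)
      case (1 t r'' m'')
      have r'': "r'' ''1'' = 1" "r'' ''d'' = d" using 1(2) r' by simp_all
      have "t \<le> 5 + 8 * N" using 1(1) le by linarith
      then show ?case using 1(1) r'' Jstep[OF J] dv by (simp add: add.commute)
    qed
  next
    case (13 t r' m')
    then show ?case unfolding J_def by (simp add: add.commute)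
  qed (use assms J0 in simp_all)
qed

text \<open>The first loop computes the power \<open>''B'' ^ ''k''\<close> by repeated addition.
  There is no early exit: \<open>C\<close> may only set \<open>''out''\<close> to 1, so that
  \<open>''out''\<close> accumulates the disjunction over all candidates.\<close>

definition Enum :: "com \<Rightarrow> com" where
  "Enum C = Const ''out'' 0 ;; Const ''M'' 1 ;;
     For ''i'' ''k'' (Const ''s'' 0 ;; For ''j'' ''B'' (Add ''s'' ''s'' ''M'') ;; Copy ''M'' ''s'') ;;
     For ''o'' ''M'' (Clear ''d'' ;; Decode ;; C)"

text \<open>The registers fixed by \<open>Parse\<close> on which every candidate test relies;
  neither \<open>Enum\<close> nor the tests write to them.\<close>

definition globals :: "reg set" where
  "globals = {''1'', ''n'', ''N'', ''B'', ''T'', ''e'', ''d'', ''y'', ''z'', ''x'', ''r'',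
     ''b'', ''g'', ''u'', ''v''}"

text \<open>Memory from address \<open>d\<close> on is scratch space that each round may leave in
  any state, since \<open>Clear\<close> restores the candidate array. Only the part below
  \<open>d\<close>, holding the input and the matrix, has to be preserved by
  \<open>C\<close>.\<close>

lemma wp_Enum:
  fixes r m \<phi>
  assumes r: "r ''1'' = 1" "r ''n'' = n" "r ''B'' = Suc n" "r ''k'' = k" "r ''d'' = d"
    and w: "written C \<subseteq> {''out'', ''K'', ''c'', ''a'', ''s'', ''q'', ''i'', ''t'', ''j'', ''f'', ''h''}"
    and C: "\<And>r' m'. \<forall>x \<in> globals. r' x = r x \<Longrightarrow> \<forall>a < d. m' a = m a \<Longrightarrow>
      wp C (\<lambda>t r'' m''. t \<le> T \<and> (\<forall>a < d. m'' a = m' a) \<and>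
        r'' ''out'' = (if \<phi> (aset m' d n) then 1 else r' ''out'')) r' m'"
  shows "wp (Enum C) (\<lambda>t r' m'.
      t \<le> 8 + k * (4 * n + 12) + Suc n ^ k * (16 + 6 * n + k * (8 * Suc n ^ k + 11) + T) \<and>
      r' ''out'' = of_bool (\<exists>S \<subseteq> {..<n}. card S \<le> k \<and> \<phi> S)) r m"
proof -
  let ?B = "Suc n"
  have wC: "''M'' \<notin> written C" "''o'' \<notin> written C" "''1'' \<notin> written C" "''k'' \<notin> written C"
    "''B'' \<notin> written C" "''d'' \<notin> written C"
    using w by auto
  have disj: "x \<notin> insert ''o'' (insert ''t'' (written (Clear ''d'' ;; Decode ;; C)))"
    if "x \<in> globals" for x
  proof -
    have "globals \<inter> {''o'', ''out'', ''K'', ''c'', ''a'', ''s'', ''q'', ''i'', ''t'', ''j'', ''f'', ''h''} = {}"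
      by (simp add: globals_def)
    then have x: "x \<notin> {''o'', ''out'', ''K'', ''c'', ''a'', ''s'', ''q'', ''i'', ''t'', ''j'', ''f'', ''h''}"
      using that by (meson disjoint_iff)
    then have "x \<notin> written C" using w by (meson insertI2 subsetD)
    then show ?thesis using x by simp
  qed
  have power: "wp (For ''i'' ''k'' (Const ''s'' 0 ;; For ''j'' ''B'' (Add ''s'' ''s'' ''M'') ;; Copy ''M'' ''s''))
      (\<lambda>t r' m'. t \<le> 3 + k * (4 * n + 12) \<and> r' ''M'' = ?B ^ k \<and> m' = m) (r(''out'' := 0, ''M'' := 1)) m"
  proof (rule wp_For[where N = k and T = "4 * n + 9" and I = "\<lambda>i r' m'. r' ''M'' = ?B ^ i \<and> m' = m"],
      goal_cases)
    case (11 i r' m')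
    have r': "r' ''1'' = 1" "r' ''B'' = ?B" using 11(4) r by simp_all
    show ?case
      unfolding wp_Seq wp_basic
    proof (rule wp_For[where N = ?B and T = 1 and
          I = "\<lambda>l r'' m''. r'' ''M'' = ?B ^ i \<and> r'' ''s'' = l * ?B ^ i \<and> m'' = m"], goal_cases)
      case (13 t r'' m'')
      then show ?case by simp
    qed (use 11 r' in simp_all)
  next
    case (13 t r' m')
    then show ?case by (simp add: algebra_simps)
  qed (use r in simp_all)
  define J where "J = (\<lambda>N m' (out :: nat). (\<forall>a < d. m' a = m a) \<and>
    out = of_bool (\<exists>N' < N. \<phi> (digits ?B k N' \<inter> {..<n})))"
  have J0: "J 0 m 0" unfolding J_def by simp
  have Jstep: "J (Suc N) m'' (if \<phi> (digits ?B k N \<inter> {..<n}) then 1 else out)"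
    if "J N m' out" "\<forall>a < d. m'' a = m' a" for N m' m'' out
    using that unfolding J_def by (auto simp: less_Suc_eq)
  show ?thesis
    unfolding Enum_def wp_Seq[of "Const _ _"] wp_basic wp_Seq[of "For _ _ _"]
  proof (rule wp_use[OF power], goal_cases)
    case (1 t0 r0 m0)
    have r0: "r0 ''1'' = 1" "r0 ''n'' = n" "r0 ''B'' = ?B" "r0 ''k'' = k" "r0 ''d'' = d"
        "r0 ''out'' = 0" "r0 ''M'' = ?B ^ k" "m0 = m" "\<forall>x \<in> globals. r0 x = r x"
      using 1 r by (simp_all add: globals_def)
    show ?case
    proof (rule wp_For[where N = "?B ^ k" and T = "13 + 6 * n + k * (8 * ?B ^ k + 11) + T" and
          I = "\<lambda>N r' m'. J N m' (r' ''out'')"], goal_cases)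
      case (11 N r' m')
      note J = 11(2)
      have r': "r' ''1'' = 1" "r' ''B'' = ?B" "r' ''k'' = k" "r' ''d'' = d" "r' ''o'' = N"
        using 11(3,4) r0 wC by simp_all
      have g': "\<forall>x \<in> globals. r' x = r x"
        using 11(4) r0(9) disj by (metis (no_types, lifting))
      have m': "\<forall>a < d. m' a = m a" using J unfolding J_def by blast
      have "N * k \<le> ?B ^ k * k" using 11(1) by (intro mult_le_mono) auto
      then have le: "k * (8 * N + 11) \<le> k * (8 * ?B ^ k + 11)" by (simp add: algebra_simps)
      show ?case
        unfolding wp_Seq
      proof (rule wp_use[OF wp_Clear[OF r'(2,1)]], goal_cases)
        case (2 t1 r1 m1)
        have r1: "r1 ''1'' = 1" "r1 ''B'' = ?B" "r1 ''k'' = k" "r1 ''d'' = d" "r1 ''o'' = N"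
            "r1 ''out'' = r' ''out''"
          using 2(2) r' by simp_all
        have g1: "\<forall>x \<in> globals. r1 x = r x" using 2(2) g' by (simp add: globals_def)
        have t1: "t1 \<le> 9 + 6 * n" using 2(1) by simp
        have m1: "\<forall>i < ?B. m1 (d + i) = 0" "\<forall>a < d. m1 a = m' a" using 2(1) r'(4) by simp_all
        show ?case
        proof (rule wp_use[OF wp_Decode[OF r1(1,2,3,5,4) _ m1(1)]], goal_cases)
          case (2 t2 r2 m2)
          have g2: "\<forall>x \<in> globals. r2 x = r x" using 2(2) g1 by (simp add: globals_def)
          have m2: "\<forall>a < d. m2 a = m' a" "\<forall>a < d. m2 a = m a" using 2(1) m1(2) m' by simp_all
          have t2: "t2 \<le> 4 + k * (8 * N + 11)" using 2(1) by blast
          have out: "r2 ''out'' = r' ''out''" using 2(2) r1(6) by simp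
          \<comment> \<open>Reading only \<open>n\<close> of the \<open>n + 1\<close> cells discards
            the dummy digit.\<close>
          have "aset m2 d n = aset m2 d ?B \<inter> {..<n}" by (auto simp: aset_def)
          also have "\<dots> = digits ?B k N \<inter> {..<n}" using 2(1) by simp
          finally have S: "aset m2 d n = digits ?B k N \<inter> {..<n}" .
          show ?case
          proof (rule wp_mono[OF C[OF g2 m2(2)]], goal_cases)
            case (1 t3 r3 m3)
            have "t1 + (t2 + t3) \<le> 13 + 6 * n + k * (8 * ?B ^ k + 11) + T"
              using 1 t1 t2 le by linarith
            moreover have "J (Suc N) m3 (r3 ''out'')"
              using Jstep[OF J, of m3] 1 m2(1) unfolding S out by simp
            ultimately show ?case by blast
          qed
        qed simp
      qed simp
    next
      case (13 t r' m')
      have "r' ''out'' = of_bool (\<exists>S \<subseteq> {..<n}. card S \<le> k \<and> \<phi> S)"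
        using 13(1) unfolding J_def digits_enumerate by blast
      moreover have "t0 \<le> 3 + k * (4 * n + 12)" using 1(1) by blast
      ultimately show ?case using 13(3) by (simp add: algebra_simps)
    qed (use r0 wC J0 in simp_all)
  qed
qed

section \<open>Reading an instance\<close>

text \<open>The code of a matrix entry when all weights are 1.\<close>

definition arc_bits :: "bool \<Rightarrow> bool list" where
  "arc_bits b = (if b then True # False # encode_nat 1 @ encode_nat 1 else [False])"

lemma encode_nat_1: "encode_nat 1 = [True, True, False]"
  by (simp add: encode_nat_pos encode_nat_0)

text \<open>After the leading bit of an arc, the code of weight 1 has 7 bits: the sign and twice the
  3 bits of \<open>encode_nat 1\<close>. It is skipped without being decoded.\<close>

definition ReadArcs :: com where
  "ReadArcs = Copy ''q'' ''e'' ;; For ''i'' ''N''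
     (Load ''c'' ''p'' ;; Store ''q'' ''c'' ;; Add ''p'' ''p'' ''1'' ;;
      IfNZ ''c'' (Add ''p'' ''p'' ''7'') Skip ;; Add ''q'' ''q'' ''1'')"

lemma written_ReadArcs [simp]: "written ReadArcs = {''q'', ''i'', ''t'', ''c'', ''p''}"
  by (auto simp: ReadArcs_def)

lemma drop_arc_bits:
  assumes "drop p xs = arc_bits b @ ys"
  shows "drop (Suc (p + (if b then 7 else 0))) xs = ys"
proof -
  have "drop (length (arc_bits b)) (drop p xs) = ys" unfolding assms by simp
  then show ?thesis by (simp add: arc_bits_def encode_nat_1[simplified] eval_nat_numeral split: if_splits)
qed

lemma wp_ReadArcs:
  assumes r: "r ''1'' = 1" "r ''7'' = 7" "r ''N'' = length es" "r ''e'' = length xs"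
    and "input xs m" "drop (r ''p'') xs = concat (map arc_bits es) @ ys"
  shows "wp ReadArcs (\<lambda>t r' m'. t \<le> 4 + length es * 9 \<and>
    (\<forall>i < length es. m' (length xs + i) = of_bool (es ! i)) \<and>
    (\<forall>a < length xs. m' a = m a) \<and> drop (r' ''p'') xs = ys \<and>
    r' ''q'' = length xs + length es) r m"
proof -
  define J where "J = (\<lambda>k p m'. (\<forall>i < k. m' (length xs + i) = of_bool (es ! i)) \<and>
    (\<forall>a < length xs. m' a = m a) \<and> drop p xs = concat (map arc_bits (drop k es)) @ ys)"
  have J0: "J 0 (r ''p'') m" using assms(6) by (simp add: J_def)
  have Jread: "m' p = of_bool (es ! k)" if "J k p m'" "k < length es" for k p m'
  proof -
    \<comment> \<open>Both arc codes begin with the matrix entry itself, so one bit settles the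
      entry.\<close>
    have "\<exists>zs. drop p xs = (es ! k) # zs"
      using that unfolding J_def by (simp add: Cons_nth_drop_Suc[symmetric] arc_bits_def)
    moreover have "input xs m'" using assms(5) that(1) unfolding J_def input_def by simp
    ultimately show ?thesis using input_Cons by blast
  qed
  have Jstep: "J (Suc k) (Suc (p + (if es ! k then 7 else 0))) (m'(length xs + k := of_bool (es ! k)))"
    if "J k p m'" "k < length es" for k p m'
  proof -
    have "drop p xs = arc_bits (es ! k) @ concat (map arc_bits (drop (Suc k) es)) @ ys"
      using that unfolding J_def by (simp add: Cons_nth_drop_Suc[symmetric])
    from drop_arc_bits[OF this] show ?thesis
      using that unfolding J_def by (simp add: less_Suc_eq)
  qed
  show ?thesis
    unfolding ReadArcs_def wp_Seq[of "Copy _ _"] wp_basic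
  proof (rule wp_For[where N = "length es" and T = 6 and
        I = "\<lambda>k r' m'. r' ''q'' = length xs + k \<and> J k (r' ''p'') m'"], goal_cases)
    case (11 k r' m')
    then have r': "r' ''q'' = length xs + k" and J: "J k (r' ''p'') m'" by blast+
    have r'': "r' ''1'' = 1" "r' ''7'' = 7" using 11(4) r by simp_all
    show ?case
      using r'' Jstep[OF J 11(1)] by (cases "es ! k") (simp_all add: r' Jread[OF J 11(1)])
  next
    case (13 t r' m')
    then have "J (length es) (r' ''p'') m'" by blast
    then show ?case using 13 unfolding J_def by simp
  qed (use assms J0 in simp_all)
qed

text \<open>
  Registers after \<open>Parse\<close>: \<open>e\<close> is the address of the adjacency matrix, \<open>T\<close> that of the target bits
  (inside the input), \<open>d\<close>, \<open>y\<close>, \<open>z\<close>, \<open>x\<close>, \<open>r\<close> are those of work arrays of \<open>n + 1\<close> cells; \<open>b\<close> is the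
  budget, and the cost is \<open>u / v\<close> with sign bit \<open>g\<close>.
\<close>

definition Parse :: com where
  "Parse = Const ''1'' 1 ;; Const ''7'' 7 ;; Copy ''e'' ''n'' ;; Const ''p'' 0 ;;
     ReadNat ''n'' ;; Const ''N'' 0 ;; For ''i'' ''n'' (Add ''N'' ''N'' ''n'') ;;
     ReadArcs ;; Copy ''d'' ''q'' ;; Copy ''T'' ''p'' ;; Add ''p'' ''p'' ''n'' ;;
     ReadNat ''b'' ;; Load ''g'' ''p'' ;; Add ''p'' ''p'' ''1'' ;; ReadNat ''u'' ;; ReadNat ''v'' ;;
     Add ''B'' ''n'' ''1'' ;; Add ''y'' ''d'' ''B'' ;; Add ''z'' ''y'' ''B'' ;;
     Add ''x'' ''z'' ''B'' ;; Add ''r'' ''x'' ''B''"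

definition parsed ::
  "nat \<Rightarrow> nat set \<Rightarrow> (nat \<times> nat) set \<Rightarrow> nat \<Rightarrow> bool \<Rightarrow> nat \<Rightarrow> nat \<Rightarrow> (reg \<Rightarrow> nat) \<Rightarrow> (nat \<Rightarrow> nat) \<Rightarrow> bool"
  where "parsed n A E b g u v r m \<longleftrightarrow>
    r ''1'' = 1 \<and> r ''n'' = n \<and> r ''N'' = n * n \<and> r ''B'' = Suc n \<and>
    r ''d'' = r ''e'' + n * n \<and> r ''y'' = r ''d'' + Suc n \<and> r ''z'' = r ''y'' + Suc n \<and>
    r ''x'' = r ''z'' + Suc n \<and> r ''r'' = r ''x'' + Suc n \<and> r ''T'' + n \<le> r ''e'' \<and>
    r ''b'' = b \<and> r ''g'' = of_bool g \<and> r ''u'' = u \<and> r ''v'' = v \<and>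
    aset m (r ''T'') n = A \<and> arel m (r ''e'') n = E"

lemma wp_Parse:
  fixes n b u v :: nat and g :: bool and es bs :: "bool list"
  defines "xs \<equiv> encode_nat n @ concat (map arc_bits es) @ bs @ encode_nat b @ g # encode_nat u @ encode_nat v"
  assumes len: "length es = n * n" "length bs = n"
    and r: "r ''n'' = length xs" and m: "input xs m"
  shows "wp Parse (\<lambda>t r' m'. t \<le> 80 * length xs \<and>
    parsed n {i. i < n \<and> bs ! i} {(i, j). i < n \<and> j < n \<and> es ! (n * i + j)} b g u v r' m') r m"
proof -
  define ys1 where "ys1 = concat (map arc_bits es) @ bs @ encode_nat b @ g # encode_nat u @ encode_nat v"
  define ys2 where "ys2 = encode_nat b @ g # encode_nat u @ encode_nat v"
  have lens: "length xs = length (encode_nat n) + length (concat (map arc_bits es)) + n +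
      length (encode_nat b) + 1 + length (encode_nat u) + length (encode_nat v)"
    unfolding xs_def using len by simp
  \<comment> \<open>Every matrix entry takes at least one bit, so the quadratic work on the matrix
    is linear in the input length.\<close>
  have "length es \<le> length (concat (map arc_bits es))"
    by (induction es) (auto simp: arc_bits_def)
  then have nn: "n * n \<le> length (concat (map arc_bits es))" using len by simp
  have x0: "drop 0 xs = encode_nat n @ ys1" by (simp add: xs_def ys1_def)
  show ?thesis
    unfolding Parse_def wp_Seq wp_basic
  proof (rule wp_use[OF wp_ReadNat[OF m, where v = n and ys = ys1]], goal_cases)
    case (4 t1 r1 m1)
    \<comment> \<open>Initially \<open>''n''\<close> is the input length. It is saved in
      \<open>''e''\<close> before being overwritten by the number of vertices, so the matrix is
      placed right behind the input.\<close>
    have r1: "r1 ''1'' = 1" "r1 ''7'' = 7" "r1 ''e'' = length xs" "r1 ''n'' = n" "m1 = m"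
      "drop (r1 ''p'') xs = ys1" and t1: "t1 \<le> 8 * length (encode_nat n)"
      using 4 r by simp_all
    have square: "wp (For ''i'' ''n'' (Add ''N'' ''N'' ''n'')) (\<lambda>t r' m'. t \<le> 3 + n * 4 \<and>
        m' = m \<and> r' ''N'' = n * n) (r1(''N'' := 0)) m1"
    proof (rule wp_For[where N = n and T = 1 and I = "\<lambda>k r' m'. r' ''N'' = k * n \<and> m' = m"], goal_cases)
      case (11 k r' m')
      then show ?case using r1 by simp
    qed (use r1 in simp_all)
    show ?case
    proof (rule wp_use[OF square], goal_cases)
      case (1 t2 r2 m2)
      have r2: "r2 ''1'' = 1" "r2 ''7'' = 7" "r2 ''N'' = length es" "r2 ''e'' = length xs"
          "r2 ''n'' = n" "m2 = m"
          "drop (r2 ''p'') xs = concat (map arc_bits es) @ bs @ ys2" and t2: "t2 \<le> 3 + n * 4"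
        using 1 r1 len by (simp_all add: ys1_def ys2_def)
      have m2: "input xs m2" using m r2(6) by simp
      show ?case
      proof (rule wp_use[OF wp_ReadArcs[OF r2(1-4) m2 r2(7)]], goal_cases)
        case (1 t3 r3 m3)
        have r3: "r3 ''1'' = 1" "r3 ''e'' = length xs" "r3 ''n'' = n" "r3 ''N'' = n * n"
            "r3 ''q'' = length xs + n * n"
            "drop (r3 ''p'') xs = bs @ ys2" and t3: "t3 \<le> 4 + n * n * 9"
          using 1 r2 len by simp_all
        have m3: "input xs m3" "\<forall>i < n * n. m3 (length xs + i) = of_bool (es ! i)"
          using 1(1) m2 len by (simp_all add: input_def)
        have drp: "drop (r3 ''p'' + n) xs = ys2"
          using r3(6) len by (metis add.commute append_eq_conv_conj drop_drop)
        have "length (drop (r3 ''p'') xs) = n + length ys2" unfolding r3(6) using len by simp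
        then have Tn: "r3 ''p'' + n \<le> length xs" by (simp add: ys2_def)
        have targets: "m3 (r3 ''p'' + i) = of_bool (bs ! i)" if "i < n" for i
        proof -
          have "xs ! (r3 ''p'' + i) = drop (r3 ''p'') xs ! i" using Tn that by simp
          then show ?thesis using m3(1) Tn that len unfolding input_def r3(6)
            by (simp add: nth_append)
        qed
        have A: "aset m3 (r3 ''p'') n = {i. i < n \<and> bs ! i}"
          using targets by (auto simp: aset_def)
        have E: "arel m3 (length xs) n = {(i, j). i < n \<and> j < n \<and> es ! (n * i + j)}"
        proof -
          have "m3 (length xs + n * i + j) = of_bool (es ! (n * i + j))" if "i < n" "j < n" for i j
          proof -
            have "n * i + j < n * Suc i" using that by simp
            also have "\<dots> \<le> n * n" using that by (intro mult_le_mono) auto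
            finally show ?thesis using m3(2) by (simp add: add.assoc)
          qed
          then show ?thesis by (auto simp: arel_def)
        qed
        show ?case
        proof (rule wp_use[OF wp_ReadNat[OF m3(1), where v = b and ys = "g # encode_nat u @ encode_nat v"]],
            goal_cases)
          case (4 t4 r4 m4)
          have r4: "r4 ''1'' = 1" "r4 ''e'' = length xs" "r4 ''n'' = n" "r4 ''N'' = n * n"
              "r4 ''d'' = length xs + n * n" "r4 ''T'' = r3 ''p''" "r4 ''b'' = b" "m4 = m3"
              "drop (r4 ''p'') xs = g # encode_nat u @ encode_nat v"
            and t4: "t4 \<le> 8 * length (encode_nat b)"
            using 4 r3 by simp_all
          note sign = input_Cons[OF m3(1) r4(9)]
          have m4: "input xs m4" using m3 r4 by simp
          show ?case
          proof (rule wp_use[OF wp_ReadNat[OF m4, where v = u and ys = "encode_nat v"]], goal_cases)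
            case (4 t5 r5 m5)
            have r5: "r5 ''1'' = 1" "r5 ''e'' = length xs" "r5 ''n'' = n" "r5 ''N'' = n * n"
                "r5 ''d'' = length xs + n * n" "r5 ''T'' = r3 ''p''" "r5 ''b'' = b" "r5 ''g'' = of_bool g"
                "r5 ''u'' = u" "m5 = m3" "drop (r5 ''p'') xs = encode_nat v"
              and t5: "t5 \<le> 8 * length (encode_nat u)"
              using 4 r4 sign by simp_all
            have m5: "input xs m5" using m3 r5 by simp
            show ?case
            proof (rule wp_use[OF wp_ReadNat[OF m5, where v = v and ys = "[]"]], goal_cases)
              case (4 t6 r6 m6)
              have r6: "r6 ''1'' = 1" "r6 ''e'' = length xs" "r6 ''n'' = n" "r6 ''N'' = n * n"
                  "r6 ''d'' = length xs + n * n" "r6 ''T'' = r3 ''p''" "r6 ''b'' = b" "r6 ''g'' = of_bool g"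
                  "r6 ''u'' = u" "r6 ''v'' = v" "m6 = m3"
                and t6: "t6 \<le> 8 * length (encode_nat v)"
                using 4 r5 by simp_all
              have time: "t1 + t2 + t3 + t4 + t5 + t6 + 30 \<le> 80 * length xs"
                using t1 t2 t3 t4 t5 t6 nn lens length_encode_nat[of n] length_encode_nat[of b]
                  length_encode_nat[of u] length_encode_nat[of v] by linarith
              show ?case
                using r6 A E Tn time unfolding parsed_def by simp
            qed (use r5 in simp_all)
          qed (use r4 sign in simp_all)
        qed (use r3 drp in \<open>simp_all add: ys2_def\<close>)
      qed
    qed
  qed (use x0 in simp_all)
qed

text \<open>\<open>parsed\<close> depends only on the registers in \<open>globals\<close> and on
  memory below \<open>''d''\<close>. It therefore survives all candidate tests.\<close>

lemma parsed_cong: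
  assumes "parsed n A E b g u v r m" "\<forall>x \<in> globals. r' x = r x" "\<forall>a < r ''d''. m' a = m a"
  shows "parsed n A E b g u v r' m'"
proof -
  have r': "r' ''1'' = r ''1''" "r' ''n'' = r ''n''" "r' ''N'' = r ''N''" "r' ''B'' = r ''B''"
    "r' ''T'' = r ''T''" "r' ''e'' = r ''e''" "r' ''d'' = r ''d''" "r' ''y'' = r ''y''"
    "r' ''z'' = r ''z''" "r' ''x'' = r ''x''" "r' ''r'' = r ''r''" "r' ''b'' = r ''b''"
    "r' ''g'' = r ''g''" "r' ''u'' = r ''u''" "r' ''v'' = r ''v''"
    using assms(2) by (simp_all add: globals_def)
  have d: "r ''d'' = r ''e'' + n * n" "r ''T'' + n \<le> r ''e''" using assms(1) unfolding parsed_def by blast+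
  have "aset m' (r ''T'') n = aset m (r ''T'') n"
    by (rule aset_cong) (use assms(3) d in simp)
  moreover have "arel m' (r ''e'') n = arel m (r ''e'') n"
    by (rule arel_cong) (use assms(3) d in simp)
  ultimately show ?thesis using assms(1) unfolding parsed_def r' by simp
qed

section \<open>The two programs\<close>

definition closure_time :: "nat \<Rightarrow> nat" where
  "closure_time n = 3 + n * n * (4 + n * (9 * n + 8) + 3)"

text \<open>With cost \<open>u / v\<close> the denominator is cleared: the number of errors times
  \<open>v\<close>, formed by repeated addition, must not exceed \<open>u\<close>, which means that
  the truncated difference vanishes. A set sign bit rejects at once.\<close>

definition CostCheck :: com where
  "CostCheck = Closure ''d'' ;; Xor ''T'' ''d'' ''y'' ;; Count ''y'' ;;
     Const ''h'' 0 ;; For ''i'' ''K'' (Add ''h'' ''h'' ''v'') ;; Sub ''h'' ''h'' ''u'' ;;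
     IfNZ ''g'' Skip (IfNZ ''h'' Skip (Const ''out'' 1))"

lemma written_CostCheck: "written CostCheck = {''K'', ''s'', ''q'', ''i'', ''t'', ''j'', ''f'', ''h'', ''out''}"
  by (auto simp: CostCheck_def)

lemma wp_CostCheck:
  assumes p: "parsed n A E b g u v r m"
  shows "wp CostCheck (\<lambda>t r' m'. t \<le> closure_time n + 23 * n + 20 \<and>
    (\<forall>a < r ''d''. m' a = m a) \<and>
    r' ''out'' = (if \<not> g \<and> card (sym_diff A (E\<^sup>* `` aset m (r ''d'') n)) * v \<le> u
      then 1 else r ''out'')) r m"
proof -
  let ?R = "E\<^sup>* `` aset m (r ''d'') n"
  have r: "r ''1'' = 1" "r ''n'' = n" "r ''N'' = n * n"
    "r ''d'' = r ''e'' + n * n" "r ''y'' = r ''d'' + Suc n" "r ''T'' + n \<le> r ''e''"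
    "r ''g'' = of_bool g" "r ''u'' = u" "r ''v'' = v"
    "aset m (r ''T'') n = A" "arel m (r ''e'') n = E"
    using p unfolding parsed_def by blast+
  show ?thesis
    unfolding CostCheck_def wp_Seq
  proof (rule wp_use[OF wp_Closure[OF r(2,3,1) refl]], goal_cases)
    case (3 t1 r1 m1)
    have r1: "r1 ''1'' = 1" "r1 ''n'' = n" "r1 ''d'' = r ''d''" "r1 ''y'' = r ''d'' + Suc n"
      "r1 ''T'' = r ''T''" "r1 ''g'' = of_bool g" "r1 ''u'' = u" "r1 ''v'' = v" "r1 ''out'' = r ''out''"
      using 3(2) r by simp_all
    have m1: "aset m1 (r ''d'') n = ?R" "\<forall>a < r ''d''. m1 a = m a" "t1 \<le> closure_time n"
      using 3(1) r by (simp_all add: closure_time_def)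
    have T: "aset m1 (r ''T'') n = A"
      unfolding r(10)[symmetric] by (rule aset_cong) (use m1(2) r in simp)
    show ?case
    proof (rule wp_use[OF wp_Xor[OF r1(2,1)]], goal_cases)
      case (6 t2 r2 m2)
      have r2: "r2 ''1'' = 1" "r2 ''n'' = n" "r2 ''y'' = r ''d'' + Suc n"
        "r2 ''g'' = of_bool g" "r2 ''u'' = u" "r2 ''v'' = v" "r2 ''out'' = r ''out''"
        using 6(2) r1 by simp_all
      have m2: "aset m2 (r ''d'' + Suc n) n = sym_diff A ?R" "\<forall>a < r ''d''. m2 a = m a"
          "t2 \<le> 3 + 12 * n"
        using 6(1) m1 unfolding r1 T by simp_all
      show ?case
      proof (rule wp_use[OF wp_Count[OF r2(2,1)]], goal_cases)
        case (2 t3 r3 m3)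
        have r3: "r3 ''1'' = 1" "r3 ''g'' = of_bool g" "r3 ''u'' = u" "r3 ''v'' = v" "r3 ''out'' = r ''out''"
            "r3 ''K'' = card (sym_diff A ?R)" "m3 = m2" "t3 \<le> 4 + 7 * n"
          using 2 r2 m2(1) by simp_all
        \<comment> \<open>This limits the repeated addition to \<open>n\<close> rounds.\<close>
        have "sym_diff A ?R \<subseteq> {..<n}"
          unfolding m2(1)[symmetric] by (rule aset_subset)
        then have K: "card (sym_diff A ?R) \<le> n" using card_mono[of "{..<n}"] by fastforce
        have mult: "wp (For ''i'' ''K'' (Add ''h'' ''h'' ''v'')) (\<lambda>t r' m'. t \<le> 3 + n * 4 \<and>
            m' = m2 \<and> r' ''h'' = card (sym_diff A ?R) * v) (r3(''h'' := 0)) m3"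
        proof (rule wp_For[where N = "card (sym_diff A ?R)" and T = 1 and
              I = "\<lambda>k r' m'. r' ''h'' = k * v \<and> m' = m2"], goal_cases)
          case (11 k r' m')
          then show ?case using r3 by simp
        next
          case (13 t r' m')
          then show ?case using K by simp
        qed (use r3 in simp_all)
        show ?case
          unfolding wp_basic
        proof (rule wp_use[OF mult], goal_cases)
          case (1 t4 r4 m4)
          have r4: "r4 ''g'' = of_bool g" "r4 ''u'' = u" "r4 ''out'' = r ''out''"
              "r4 ''h'' = card (sym_diff A ?R) * v" "m4 = m2" "t4 \<le> 3 + n * 4"
            using 1 r3 by simp_all
          have time: "t1 + t2 + t3 + t4 + 7 \<le> closure_time n + 23 * n + 20"
            using m1(3) m2(3) r3(8) r4(6) by linarith
          show ?case using r4 m2(2) time by (cases g) simp_all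
        qed
      qed (use m2 in simp_all)
    qed (use r1 r in simp_all)
  qed (use r in simp_all)
qed

text \<open>Array \<open>''y''\<close> holds \<open>R\<close> and \<open>''z''\<close> the current
  generators. \<open>''x''\<close> receives the closure without node \<open>''a''\<close>,
  \<open>''r''\<close> its difference from \<open>R\<close>, and \<open>''d''\<close> is kept empty
  as the second operand for copying.\<close>

definition PruneStep :: com where
  "PruneStep = Xor ''z'' ''d'' ''x'' ;; Add ''h'' ''x'' ''a'' ;; Const ''f'' 0 ;; Store ''h'' ''f'' ;;
     Closure ''x'' ;; Xor ''x'' ''y'' ''r'' ;; Count ''r'' ;;
     IfNZ ''K'' Skip (Add ''h'' ''z'' ''a'' ;; Const ''f'' 0 ;; Store ''h'' ''f'')"

lemma written_PruneStep [simp]: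
  "written PruneStep = {''K'', ''s'', ''q'', ''i'', ''t'', ''j'', ''f'', ''h''}"
  by (auto simp: PruneStep_def)

lemma aset_remove: "aset (m(b + v := 0)) b n = aset m b n - {v}"
  by (auto simp: aset_def)

lemma sym_diff_empty_iff: "sym_diff A B = {} \<longleftrightarrow> A = B"
  by blast

text \<open>The case \<open>w = n\<close> is included: the arrays have \<open>n + 1\<close> cells,
  so the removal then hits the spare cell. The test result is left in \<open>''K''\<close> for the
  caller to read after the last round.\<close>

lemma wp_PruneStep:
  fixes m :: "nat \<Rightarrow> nat"
  assumes p: "parsed n A E b g u v r m" and a: "r ''a'' = w" "w \<le> n"
    and d: "aset m (r ''d'') n = {}" and y: "aset m (r ''y'') n = R" and z: "aset m (r ''z'') n = X"
  shows "wp PruneStep (\<lambda>t r' m'. t \<le> closure_time n + 31 * n + 17 \<and>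
    (\<forall>a < r ''z''. m' a = m a) \<and>
    aset m' (r ''z'') n = (if E\<^sup>* `` (X - {w}) = R then X - {w} else X) \<and>
    (r' ''K'' = 0 \<longleftrightarrow> E\<^sup>* `` (X - {w}) = R)) r m"
proof -
  let ?Z = "E\<^sup>* `` (X - {w})"
  have r: "r ''1'' = 1" "r ''n'' = n" "r ''N'' = n * n"
    "r ''d'' = r ''e'' + n * n" "r ''y'' = r ''d'' + Suc n" "r ''z'' = r ''y'' + Suc n"
    "r ''x'' = r ''z'' + Suc n" "r ''r'' = r ''x'' + Suc n" "r ''T'' + n \<le> r ''e''"
    "aset m (r ''T'') n = A" "arel m (r ''e'') n = E"
    using p unfolding parsed_def by blast+
  show ?thesis
    unfolding PruneStep_def wp_Seq[of "Xor ''z'' ''d'' ''x''"] wp_Seq[of "Add _ _ _"]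
      wp_Seq[of "Const _ _"] wp_Seq[of "Store _ _"]
  proof (rule wp_use[OF wp_Xor[OF r(2,1)]], goal_cases)
    case (6 t1 r1 m1)
    define m1' where "m1' = m1(r ''x'' + w := 0)"
    define r1' where "r1' = r1(''h'' := r ''x'' + w, ''f'' := 0)"
    have r1: "r1' ''1'' = 1" "r1' ''n'' = n" "r1' ''N'' = n * n" "r1' ''e'' = r ''e''"
      "r1' ''x'' = r ''x''" "r1' ''y'' = r ''y''" "r1' ''z'' = r ''z''" "r1' ''r'' = r ''r''" "r1' ''a'' = w"
      and r1x: "r1 ''x'' = r ''x''" "r1 ''a'' = w"
      using 6(2) r a by (simp_all add: r1'_def)
    have t1: "t1 \<le> 3 + 12 * n" using 6(1) by blast
    have "aset m1 (r ''x'') n = X" using 6(1) unfolding d z by simp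
    then have x: "aset m1' (r ''x'') n = X - {w}" unfolding m1'_def aset_remove by simp
    have m1: "\<forall>a < r ''x''. m1' a = m a" using 6(1) unfolding m1'_def by simp
    have E1: "arel m1' (r ''e'') n = E"
      unfolding r(11)[symmetric] by (rule arel_cong) (use m1 r in simp)
    have "wp (Closure ''x'' ;; Xor ''x'' ''y'' ''r'' ;; Count ''r'' ;;
        IfNZ ''K'' Skip (Add ''h'' ''z'' ''a'' ;; Const ''f'' 0 ;; Store ''h'' ''f''))
      (\<lambda>t r' m'. t \<le> closure_time n + 19 * n + 11 \<and>
        (\<forall>a < r ''z''. m' a = m a) \<and>
        aset m' (r ''z'') n = (if ?Z = R then X - {w} else X) \<and>
        (r' ''K'' = 0 \<longleftrightarrow> ?Z = R)) r1' m1'"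
      unfolding wp_Seq
    proof (rule wp_use[OF wp_Closure[OF r1(2,3,1,4)]], goal_cases)
      case (3 t2 r2 m2)
      have r2: "r2 ''1'' = 1" "r2 ''n'' = n" "r2 ''x'' = r ''x''" "r2 ''y'' = r ''y''"
        "r2 ''z'' = r ''z''" "r2 ''r'' = r ''r''" "r2 ''a'' = w"
        using 3(2) r1 by simp_all
      have m2: "aset m2 (r ''x'') n = ?Z" "\<forall>a < r ''x''. m2 a = m a" "t2 \<le> closure_time n"
        using 3(1) m1 unfolding r1 x E1 by (simp_all add: closure_time_def)
      have y2: "aset m2 (r ''y'') n = R"
        unfolding y[symmetric] by (rule aset_cong) (use m2(2) r in simp)
      show ?case
      proof (rule wp_use[OF wp_Xor[OF r2(2,1)]], goal_cases)
        case (6 t3 r3 m3)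
        have r3: "r3 ''1'' = 1" "r3 ''n'' = n" "r3 ''z'' = r ''z''" "r3 ''r'' = r ''r''" "r3 ''a'' = w"
          using 6(2) r2 by simp_all
        have m3: "aset m3 (r ''r'') n = sym_diff ?Z R" "\<forall>a < r ''x''. m3 a = m a" "t3 \<le> 3 + 12 * n"
          using 6(1) m2 r unfolding r2 y2 by simp_all
        have z3: "aset m3 (r ''z'') n = X"
          unfolding z[symmetric] by (rule aset_cong) (use m3(2) r in simp)
        show ?case
        proof (rule wp_use[OF wp_Count[OF r3(2,1)]], goal_cases)
          case (2 t4 r4 m4)
          have r4: "r4 ''z'' = r ''z''" "r4 ''a'' = w" "m4 = m3" "t4 \<le> 4 + 7 * n"
              "r4 ''K'' = card (sym_diff ?Z R)"
            using 2 r3 m3(1) by simp_all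
          have fin: "finite (sym_diff ?Z R)" unfolding m3(1)[symmetric] by simp
          have K: "r4 ''K'' = 0 \<longleftrightarrow> ?Z = R"
            unfolding r4(5) card_0_eq[OF fin] sym_diff_empty_iff ..
          have time: "t2 + (t3 + (t4 + 4)) \<le> closure_time n + 19 * n + 11"
            using m2(3) m3(3) r4(4) by linarith
          have zx: "r ''z'' \<le> r ''x''" "r ''z'' + w < r ''x''" using r a by simp_all
          show ?case
          proof (cases "?Z = R")
            case True
            then show ?thesis using K time zx m3(2) z3 by (simp add: r4 aset_remove)
          next
            case False
            then show ?thesis using K time zx m3(2) z3 by (simp add: r4)
          qed
        qed simp
      qed (use r2 r in simp_all)
    qed (use r1 r in simp_all)
    note tail = this
    have st: "r1(''h'' := r1 ''x'' + r1 ''a'', ''f'' := 0) = r1'" "m1(r1' ''h'' := r1' ''f'') = m1'"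
      by (simp_all add: r1'_def m1'_def r1x)
    show ?case
      unfolding wp_basic st by (rule wp_mono[OF tail]) (use t1 in \<open>auto split: if_splits\<close>)
  qed (use r in simp_all)
qed

text \<open>The loop runs up to the dummy node \<open>n\<close>, whose removal changes nothing: the last round thus
  tests whether the pruned set still generates \<open>R\<close>, which fails exactly if \<open>R\<close> is not closed.\<close>

definition ErrorCheck :: com where
  "ErrorCheck = Xor ''T'' ''d'' ''y'' ;; Clear ''d'' ;; Xor ''y'' ''d'' ''z'' ;;
     For ''a'' ''B'' PruneStep ;; Copy ''c'' ''K'' ;; Count ''z'' ;; Sub ''K'' ''K'' ''b'' ;;
     IfNZ ''c'' Skip (IfNZ ''K'' Skip (Const ''out'' 1))"

lemma written_ErrorCheck:
  "written ErrorCheck = {''K'', ''a'', ''c'', ''s'', ''q'', ''i'', ''t'', ''j'', ''f'', ''h'', ''out''}"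
  by (auto simp: ErrorCheck_def)

definition check_time :: "nat \<Rightarrow> nat" where
  "check_time n = 27 + 37 * n + Suc n * (closure_time n + 31 * n + 20)"

text \<open>The candidate in \<open>''d''\<close> is needed only to form \<open>R\<close>. It can
  then be cleared and act as the empty set in the copies made by \<open>PruneStep\<close>.\<close>

lemma wp_ErrorCheck:
  assumes p: "parsed n A E b g u v r m"
  defines "R \<equiv> sym_diff A (aset m (r ''d'') n)"
  shows "wp ErrorCheck (\<lambda>t r' m'. t \<le> check_time n \<and>
    (\<forall>a < r ''d''. m' a = m a) \<and>
    r' ''out'' = (if E\<^sup>* `` prune E R n = R \<and> card (prune E R n) \<le> b
      then 1 else r ''out'')) r m"
proof -
  have r: "r ''1'' = 1" "r ''n'' = n" "r ''B'' = Suc n"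
    "r ''d'' = r ''e'' + n * n" "r ''y'' = r ''d'' + Suc n" "r ''z'' = r ''y'' + Suc n"
    "r ''T'' + n \<le> r ''e''" "r ''b'' = b" "aset m (r ''T'') n = A"
    using p unfolding parsed_def by blast+
  show ?thesis
    unfolding ErrorCheck_def wp_Seq
  proof (rule wp_use[OF wp_Xor[OF r(2,1)]], goal_cases)
    case (6 t1 r1 m1)
    have r1: "r1 ''1'' = 1" "r1 ''n'' = n" "r1 ''B'' = Suc n" "r1 ''d'' = r ''d''" "r1 ''y'' = r ''y''"
        "r1 ''z'' = r ''z''" "r1 ''b'' = b" "r1 ''out'' = r ''out''"
        "\<forall>x \<in> globals. r1 x = r x"
      using 6(2) r by (simp_all add: globals_def)
    have m1: "aset m1 (r ''y'') n = R" "\<forall>a < r ''y''. m1 a = m a" "t1 \<le> 3 + 12 * n"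
      using 6(1) unfolding r(9) R_def by simp_all
    show ?case
    proof (rule wp_use[OF wp_Clear[OF r1(3,1)]], goal_cases)
      case (2 t2 r2 m2)
      have r2: "r2 ''1'' = 1" "r2 ''n'' = n" "r2 ''B'' = Suc n" "r2 ''d'' = r ''d''" "r2 ''y'' = r ''y''"
          "r2 ''z'' = r ''z''" "r2 ''b'' = b" "r2 ''out'' = r ''out''"
          "\<forall>x \<in> globals. r2 x = r x"
        using 2(2) r1 by (simp_all add: globals_def)
      have m2: "aset m2 (r ''d'') n = {}" "\<forall>a < r ''d''. m2 a = m a" "t2 \<le> 3 + 6 * Suc n"
        "\<forall>a \<ge> r ''y''. m2 a = m1 a"
        using 2(1) m1(2) r unfolding r1 by (simp_all add: aset_def)
      have y2: "aset m2 (r ''y'') n = R"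
        unfolding m1(1)[symmetric] by (rule aset_cong) (use m2(4) in simp)
      show ?case
      proof (rule wp_use[OF wp_Xor[OF r2(2,1)]], goal_cases)
        case (6 t3 r3 m3)
        have r3: "r3 ''1'' = 1" "r3 ''n'' = n" "r3 ''B'' = Suc n" "r3 ''d'' = r ''d''" "r3 ''y'' = r ''y''"
            "r3 ''z'' = r ''z''" "r3 ''b'' = b" "r3 ''out'' = r ''out''"
            "\<forall>x \<in> globals. r3 x = r x"
          using 6(2) r2 by (simp_all add: globals_def)
        have m3: "aset m3 (r ''z'') n = R" "\<forall>a < r ''z''. m3 a = m2 a" "t3 \<le> 3 + 12 * n"
          using 6(1) unfolding r2 y2 m2(1) by simp_all
        have m3': "\<forall>a < r ''d''. m3 a = m a" using m3(2) m2(2) r by simp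
        have y3: "aset m3 (r ''y'') n = R"
          unfolding y2[symmetric] by (rule aset_cong) (use m3(2) r in simp)
        have d3: "aset m3 (r ''d'') n = {}"
          unfolding m2(1)[symmetric] by (rule aset_cong) (use m3(2) r in simp)
        define J where "J = (\<lambda>w m'. (\<forall>a < r ''z''. m' a = m3 a) \<and> aset m' (r ''z'') n = prune E R w)"
        \<comment> \<open>The outcome of the latest round, that of node \<open>w - 1\<close>,
          travels with the invariant. Before the first round there is none, hence the exception
          \<open>w = 0\<close>.\<close>
        define test where "test = (\<lambda>w x. w = 0 \<or>
          ((x :: nat) = 0 \<longleftrightarrow> E\<^sup>* `` (prune E R (w - 1) - {w - 1}) = R))"
        have J0: "J 0 m3" "test 0 x" for x unfolding J_def test_def using m3(1) by simp_all
        have loop: "wp (For ''a'' ''B'' PruneStep) (\<lambda>t r' m'.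
            t \<le> 3 + Suc n * (closure_time n + 31 * n + 20) \<and> J (Suc n) m' \<and> test (Suc n) (r' ''K'')) r3 m3"
        proof (rule wp_For[where N = "Suc n" and T = "closure_time n + 31 * n + 17" and
              I = "\<lambda>w r' m'. J w m' \<and> test w (r' ''K'')"], goal_cases)
          case (11 w r' m')
          have J: "J w m'" using 11(2) by blast
          have r': "r' ''d'' = r ''d''" "r' ''y'' = r ''y''" "r' ''z'' = r ''z''"
            "\<forall>x \<in> globals. r' x = r x"
            using 11(4) r3 by (simp_all add: globals_def)
          have below: "\<forall>a < r ''z''. m' a = m3 a" using J unfolding J_def by blast
          then have "\<forall>a < r ''d''. m' a = m a" using m3' r by simp
          from parsed_cong[OF p r'(4) this] have p': "parsed n A E b g u v r' m'" .
          have d': "aset m' (r' ''d'') n = {}"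
            unfolding d3[symmetric] r' by (rule aset_cong) (use below r in simp)
          have y': "aset m' (r' ''y'') n = R"
            unfolding y3[symmetric] r' by (rule aset_cong) (use below r in simp)
          have z': "aset m' (r' ''z'') n = prune E R w" using J unfolding r' J_def by blast
          show ?case
          proof (rule wp_mono[OF wp_PruneStep[OF p' 11(3) _ d' y' z']], goal_cases)
            case (2 t r'' m'')
            then have "J (Suc w) m''" using below unfolding J_def r' by simp
            moreover have "test (Suc w) (r'' ''K'')" using 2 unfolding test_def by simp
            ultimately show ?case using 2 by simp
          qed (use 11(1) in simp)
        next
          case (13 t r' m')
          then show ?case by (simp add: algebra_simps)
        qed (use r3 J0 in simp_all)
        show ?case
        proof (rule wp_use[OF loop], goal_cases)
          case (1 t4 r4 m4)
          have R: "R \<subseteq> {..<n}" using aset_subset[of m1 "r ''y''" n] unfolding m1(1) .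
          then have n: "n \<notin> prune E R n" using prune_subset by blast
          then have last: "prune E R (Suc n) = prune E R n" by simp
          have r4: "r4 ''1'' = 1" "r4 ''n'' = n" "r4 ''z'' = r ''z''" "r4 ''b'' = b" "r4 ''out'' = r ''out''"
              "r4 ''K'' = 0 \<longleftrightarrow> E\<^sup>* `` prune E R n = R"
            using 1 r3 n unfolding test_def by simp_all
          have m4: "\<forall>a < r ''d''. m4 a = m a" "aset m4 (r ''z'') n = prune E R n"
            using 1(1) m3' r unfolding J_def last by simp_all
          have t4: "t4 \<le> 3 + Suc n * (closure_time n + 31 * n + 20)" using 1(1) by blast
          have r4': "(r4(''c'' := r4 ''K'')) ''n'' = n" "(r4(''c'' := r4 ''K'')) ''1'' = 1"
            using r4 by simp_all
          show ?case
            unfolding wp_basic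
          proof (rule wp_use[OF wp_Count[OF r4']], goal_cases)
            case (2 t5 r5 m5)
            have r5: "r5 ''c'' = r4 ''K''" "r5 ''b'' = b" "r5 ''out'' = r ''out''"
                "r5 ''K'' = card (prune E R n)" "m5 = m4" "t5 \<le> 4 + 7 * n"
              using 2 r4 m4 by simp_all
            have "t1 + t2 + t3 + t4 + t5 + 5 \<le> check_time n"
              using m1(3) m2(3) m3(3) t4 r5(6) unfolding check_time_def by simp
            then show ?case using r5 r4(6) m4(1) by simp
          qed simp
        qed
      qed (use r2 r in simp_all)
    qed simp
  qed (use r in simp_all)
qed

text \<open>For truncated subtraction, \<open>K - (K - b)\<close> is \<open>min K b\<close>, where
  \<open>K\<close> is the number of targets.\<close>

definition TargetsProgram :: com where
  "TargetsProgram = Parse ;; Count ''T'' ;; Sub ''c'' ''K'' ''b'' ;; Sub ''k'' ''K'' ''c'' ;; Enum CostCheck"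

text \<open>A natural cost has denominator 1, so its numerator \<open>''u''\<close> bounds the
  number of errors to be guessed. The enumeration itself then enforces the cost bound.\<close>

definition CostProgram :: com where
  "CostProgram = Parse ;; Copy ''k'' ''u'' ;; Enum ErrorCheck"

text \<open>One bound for both programs: \<open>80 * L\<close> is for parsing, \<open>7 * n\<close>
  for counting the targets, and \<open>check_time n\<close> also dominates the time of
  \<open>CostCheck\<close>.\<close>

definition total_time :: "nat \<Rightarrow> nat \<Rightarrow> nat \<Rightarrow> nat" where
  "total_time L n k = 80 * L + 7 * n + 14 +
     k * (4 * n + 12) + Suc n ^ k * (16 + 6 * n + k * (8 * Suc n ^ k + 11) + check_time n)"

text \<open>Bit strings of the right shape, without reference to vertices: the correctness of the
  programs is a statement about index sets below \<open>n\<close>.\<close>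

locale parsed_input =
  fixes n b u v :: nat and g :: bool and es bs xs :: "bool list" and A E
  assumes xs: "xs = encode_nat n @ concat (map arc_bits es) @ bs @ encode_nat b @
      g # encode_nat u @ encode_nat v"
    and len: "length es = n * n" "length bs = n"
  defines "A \<equiv> {i. i < n \<and> bs ! i}"
    and "E \<equiv> {(i, j). i < n \<and> j < n \<and> es ! (n * i + j)}"
begin

lemma parse: "wp Parse (\<lambda>t r' m'. t \<le> 80 * length xs \<and> parsed n A E b g u v r' m')
    (fst (bits_input xs)) (snd (bits_input xs))"
  unfolding A_def E_def xs
  by (rule wp_Parse[OF len]) (simp_all add: bits_input_def input_def xs)

lemma answers_within_wp:
  assumes "wp P (\<lambda>t r' m'. t \<le> T \<and> r' ''out'' = of_bool c) (fst (bits_input xs)) (snd (bits_input xs))"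
  shows "answers_within P xs c T"
  using assms unfolding wp_def answers_within_def by fastforce

lemma TargetsProgram:
  "answers_within TargetsProgram xs
    (\<exists>S \<subseteq> {..<n}. card S \<le> min (card A) b \<and> \<not> g \<and> card (sym_diff A (E\<^sup>* `` S)) * v \<le> u)
    (total_time (length xs) n (min (card A) b))"
proof (rule answers_within_wp, unfold TargetsProgram_def wp_Seq, rule wp_mono[OF parse], goal_cases)
  case (1 t r m)
  then have p: "parsed n A E b g u v r m" by blast
  then have r: "r ''1'' = 1" "r ''n'' = n" "r ''B'' = Suc n" "r ''b'' = b" "aset m (r ''T'') n = A"
    unfolding parsed_def by blast+
  show ?case
  proof (rule wp_use[OF wp_Count[OF r(2,1)]], goal_cases)
    case (2 t1 r1 m1)
    define r2 where "r2 = r1(''c'' := r1 ''K'' - r1 ''b'', ''k'' := r1 ''K'' - (r1 ''K'' - r1 ''b''))"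
    have m1: "m1 = m" "t1 \<le> 4 + 7 * n" using 2(1) by simp_all
    have r2: "r2 ''1'' = 1" "r2 ''n'' = n" "r2 ''B'' = Suc n" "r2 ''k'' = min (card A) b"
        "r2 ''d'' = r ''d''" "\<forall>x \<in> globals. r2 x = r x"
      using 2 r unfolding r2_def by (simp_all add: globals_def)
    have Sub: "r1(''c'' := r1 ''K'' - r1 ''b'', ''k'' := (r1(''c'' := r1 ''K'' - r1 ''b'')) ''K'' -
        (r1(''c'' := r1 ''K'' - r1 ''b'')) ''c'') = r2"
      unfolding r2_def by simp
    show ?case
      unfolding wp_basic Sub
    proof (rule wp_mono[OF wp_Enum[OF r2(1-5), where T = "check_time n" and
            \<phi> = "\<lambda>S. \<not> g \<and> card (sym_diff A (E\<^sup>* `` S)) * v \<le> u"]], goal_cases)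
      case 1
      show ?case unfolding written_CostCheck by simp
    next
      case (2 r' m')
      have r': "\<forall>x \<in> globals. r' x = r x" "r' ''d'' = r ''d''"
        using 2(1) r2(5,6) by (simp_all add: globals_def)
      have m': "\<forall>a < r ''d''. m' a = m a" using 2(2) m1 by simp
      have "closure_time n + 23 * n + 20 \<le> check_time n" unfolding check_time_def by simp
      then show ?case
        using wp_CostCheck[OF parsed_cong[OF p r'(1) m']] unfolding r'(2)
        by (elim wp_mono) auto
    next
      case (3 t' r' m')
      then show ?case using 1 m1(2) unfolding total_time_def by simp
    qed
  qed simp
qed

lemma CostProgram:
  "answers_within CostProgram xs
    (\<exists>S \<subseteq> {..<n}. card S \<le> u \<and> E\<^sup>* `` prune E (sym_diff A S) n = sym_diff A S \<and>
      card (prune E (sym_diff A S) n) \<le> b)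
    (total_time (length xs) n u)"
proof (rule answers_within_wp, unfold CostProgram_def wp_Seq, rule wp_mono[OF parse], goal_cases)
  case (1 t r m)
  then have p: "parsed n A E b g u v r m" by blast
  then have r: "r ''1'' = 1" "r ''n'' = n" "r ''B'' = Suc n" "r ''u'' = u"
    unfolding parsed_def by blast+
  define r2 where "r2 = r(''k'' := r ''u'')"
  have r2: "r2 ''1'' = 1" "r2 ''n'' = n" "r2 ''B'' = Suc n" "r2 ''k'' = u"
      "r2 ''d'' = r ''d''" "\<forall>x \<in> globals. r2 x = r x"
    using r unfolding r2_def by (simp_all add: globals_def)
  show ?case
    unfolding wp_basic r2_def[symmetric]
  proof (rule wp_mono[OF wp_Enum[OF r2(1-5), where T = "check_time n" and
          \<phi> = "\<lambda>S. E\<^sup>* `` prune E (sym_diff A S) n = sym_diff A S \<and>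
            card (prune E (sym_diff A S) n) \<le> b"]], goal_cases)
    case 1
    show ?case unfolding written_ErrorCheck by simp
  next
    case (2 r' m')
    have r': "\<forall>x \<in> globals. r' x = r x" "r' ''d'' = r ''d''"
      using 2(1) r2(5,6) by (simp_all add: globals_def)
    show ?case
      using wp_ErrorCheck[OF parsed_cong[OF p r'(1) 2(2)]] unfolding r'(2) .
  next
    case (3 t' r' m')
    then show ?case using 1 unfolding total_time_def by simp
  qed
qed

end

section \<open>The cascade without probabilistic arcs\<close>

lemma (in influence_graph) weight_eq_1:
  assumes "probabilistic_arcs G w = 0" "e \<in> parcs G"
  shows "w e = 1"
proof -
  have "finite {e \<in> parcs G. w e < 1}" using pair_finite_arcs by simp
  then have "{e \<in> parcs G. w e < 1} = {}" using assms(1) unfolding probabilistic_arcs_def by simp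
  then have "\<not> w e < 1" using assms(2) by blast
  then show ?thesis using weight_le_1[OF assms(2)] by simp
qed

text \<open>A Bernoulli distribution with parameter 1 is a point mass at \<open>True\<close>, so the
  product is a point mass at the function that succeeds on exactly the attempted arcs.\<close>

lemma (in influence_graph) cascade_step_deterministic:
  assumes "probabilistic_arcs G w = 0"
  shows "cascade_step G w \<sigma> =
    return_pmf (fst \<sigma> \<union> snd ` attempts G \<sigma>, snd ` attempts G \<sigma>)"
proof -
  have fin: "finite (attempts G \<sigma>)"
    by (rule finite_subset[OF _ pair_finite_arcs]) (auto simp: attempts_def)
  have "bernoulli_pmf (real_of_rat (w e)) = return_pmf True" if "e \<in> attempts G \<sigma>" for e
  proof (rule pmf_eqI)
    have "w e = 1" using that weight_eq_1[OF assms, of e] by (auto simp: attempts_def)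
    then show "pmf (bernoulli_pmf (real_of_rat (w e))) b = pmf (return_pmf True) b" for b
      by (cases b) simp_all
  qed
  then have "Pi_pmf (attempts G \<sigma>) False (\<lambda>e. bernoulli_pmf (real_of_rat (w e))) =
      Pi_pmf (attempts G \<sigma>) False (\<lambda>e. return_pmf True)"
    by (intro Pi_pmf_cong) auto
  also have "\<dots> = return_pmf (\<lambda>e. if e \<in> attempts G \<sigma> then True else False)"
    using fin by (simp add: Pi_pmf_return_pmf)
  finally show ?thesis
    unfolding cascade_step_def by (simp add: Let_def)
qed

text \<open>The last conjunct of the invariant carries the argument: only the newly active nodes
  \<open>N\<close> can have inactive out-neighbours. Once \<open>N\<close> is empty,
  \<open>S\<close> is closed under arcs.\<close>

lemma (in influence_graph) cascade_deterministic:
  assumes "probabilistic_arcs G w = 0"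
  shows "\<exists>S N. cascade G w X t = return_pmf (S, N) \<and> X \<subseteq> S \<and> S \<subseteq> (parcs G)\<^sup>* `` X \<and>
    N \<subseteq> S \<and> parcs G `` (S - N) \<subseteq> S"
proof (induction t)
  case (Suc t)
  then obtain S N where IH: "cascade G w X t = return_pmf (S, N)" "X \<subseteq> S"
    "S \<subseteq> (parcs G)\<^sup>* `` X" "N \<subseteq> S" "parcs G `` (S - N) \<subseteq> S" by blast
  define N' where "N' = snd ` attempts G (S, N)"
  have "N' \<subseteq> parcs G `` S" using IH(4) by (force simp: N'_def attempts_def)
  then have "N' \<subseteq> (parcs G)\<^sup>* `` X" using IH(3) by (blast intro: rtrancl_into_rtrancl)
  moreover have "parcs G `` S \<subseteq> S \<union> N'"
    using IH(5) by (force simp: N'_def attempts_def image_iff)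
  ultimately have "S \<union> N' \<subseteq> (parcs G)\<^sup>* `` X \<and> N' \<subseteq> S \<union> N' \<and> X \<subseteq> S \<union> N' \<and>
      parcs G `` (S \<union> N' - N') \<subseteq> S \<union> N'"
    using IH by blast
  moreover have "cascade G w X (Suc t) = return_pmf (S \<union> N', N')"
    using IH(1) cascade_step_deterministic[OF assms] by (simp add: bind_return_pmf N'_def)
  ultimately show ?case by blast
qed auto

lemma (in influence_graph) activation_prob_deterministic:
  assumes "probabilistic_arcs G w = 0" "X \<subseteq> pverts G"
  shows "activation_prob G w X v = of_bool (v \<in> (parcs G)\<^sup>* `` X)"
proof -
  obtain S N where S: "cascade G w X (card (pverts G)) = return_pmf (S, N)" "X \<subseteq> S"
    "S \<subseteq> (parcs G)\<^sup>* `` X" "parcs G `` (S - N) \<subseteq> S"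
    using cascade_deterministic[OF assms(1)] by metis
  \<comment> \<open>Termination by time \<open>card (pverts G)\<close> turns the invariant into
    closedness of \<open>S\<close>.\<close>
  have "N = {}" using cascade_terminated[OF assms(2), of "(S, N)"] S(1) by simp
  then have "(parcs G)\<^sup>* `` S \<subseteq> S" using S(4) by (simp add: Image_closed_trancl)
  then have "(parcs G)\<^sup>* `` X = S" using S by blast
  then show ?thesis unfolding activation_prob_def S(1) by (simp add: measure_return_pmf indicator_def)
qed

lemma (in influence_graph) effector_cost_deterministic:
  assumes "probabilistic_arcs G w = 0" "X \<subseteq> pverts G" "A \<subseteq> pverts G"
  shows "effector_cost G w A X = card (sym_diff A ((parcs G)\<^sup>* `` X))"
proof -
  let ?R = "(parcs G)\<^sup>* `` X"
  have "y \<in> pverts G" if "(x, y) \<in> (parcs G)\<^sup>*" "x \<in> pverts G" for x y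
    using that by (induction rule: rtrancl_induct) (auto dest: arc_snd_in_verts)
  then have R: "?R \<subseteq> pverts G" using assms(2) by blast
  have fin: "finite A" "finite (pverts G)" "finite ?R"
    using assms(3) R pair_finite_verts finite_subset by metis+
  have "(\<Sum>v\<in>A. 1 - of_bool (v \<in> ?R) :: real) = card (A - ?R)"
    using fin by (simp add: sum.If_cases of_bool_def if_distrib Diff_eq Compl_eq cong: if_cong)
  moreover have "(\<Sum>v\<in>pverts G - A. of_bool (v \<in> ?R) :: real) = card ((pverts G - A) \<inter> ?R)"
    using fin by (simp add: sum.If_cases of_bool_def)
  moreover have "(pverts G - A) \<inter> ?R = ?R - A" using R by blast
  moreover have "card (sym_diff A ?R) = card (A - ?R) + card (?R - A)"
    using fin by (intro card_Un_disjoint) auto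
  ultimately show ?thesis
    unfolding effector_cost_def activation_prob_deterministic[OF assms(1,2)] by simp
qed

section \<open>From instances to arrays\<close>

lemma total_time_bound:
  assumes "n < L" "2 \<le> L"
  shows "total_time L n k \<le> L ^ (6 * k + 20)"
proof -
  \<comment> \<open>A common bound for \<open>L\<close>, \<open>n + 1\<close>, \<open>k\<close> and
    \<open>Suc n ^ k\<close>, which reduces the claim to a polynomial of degree 6 in
    \<open>Z\<close>.\<close>
  define Z where "Z = L ^ Suc k"
  have L1: "1 \<le> L" using assms(2) by simp
  have pow: "L ^ k \<le> Z" "L \<le> Z" unfolding Z_def using L1 by simp_all
  have n: "n \<le> Z" "Suc n \<le> Z" using assms(1) pow(2) by simp_all
  have "k < 2 ^ k" by (rule less_exp)
  also have "\<dots> \<le> L ^ k" using assms(2) by (rule power_mono) simp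
  finally have k: "k \<le> Z" using pow(1) by simp
  have "Suc n ^ k \<le> L ^ k" using assms(1) by (intro power_mono) simp_all
  then have M: "Suc n ^ k \<le> Z" using pow(1) by simp
  have Z1: "1 \<le> Z" using pow(2) L1 by simp
  have Zp: "Z ^ i \<le> Z ^ 6" if "i \<le> 6" for i using Z1 that by (intro power_increasing)
  note Zps = Zp[of 0] Zp[of 1] Zp[of 2] Zp[of 3] Zp[of 4] Zp[of 5]
  have "closure_time n \<le> 3 + Z * Z * (4 + Z * (9 * Z + 8) + 3)"
    unfolding closure_time_def using n(1) by (intro add_mono mult_mono) simp_all
  then have check: "check_time n \<le> 27 + 37 * Z + Z * (3 + Z * Z * (4 + Z * (9 * Z + 8) + 3) + 31 * Z + 20)"
    unfolding check_time_def using n by (intro add_mono mult_mono) simp_all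
  have "total_time L n k \<le> 80 * Z + 7 * Z + 14 + Z * (4 * Z + 12) + Z * (16 + 6 * Z + Z * (8 * Z + 11) +
      (27 + 37 * Z + Z * (3 + Z * Z * (4 + Z * (9 * Z + 8) + 3) + 31 * Z + 20)))"
    unfolding total_time_def using n k M pow(2) check by (intro add_mono mult_mono) simp_all
  also have "\<dots> = 14 + 142 * Z + 81 * Z ^ 2 + 39 * Z ^ 3 + 7 * Z ^ 4 + 8 * Z ^ 5 + 9 * Z ^ 6"
    by (simp add: algebra_simps power_numeral_reduce)
  \<comment> \<open>The coefficients add up to 300. The power \<open>2 ^ 10\<close> is generous and
    is absorbed by \<open>L ^ 10\<close>, since \<open>L\<close> is at least 2.\<close>
  also have "\<dots> \<le> 1024 * Z ^ 6"
    using Zps unfolding power_0 power_one_right by linarith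
  also have "\<dots> = 2 ^ 10 * Z ^ 6" by simp
  also have "\<dots> \<le> L ^ 10 * Z ^ 6"
    using assms(2) by (intro mult_right_mono power_mono) simp_all
  also have "\<dots> = L ^ (6 * k + 16)"
    unfolding Z_def by (simp add: power_mult[symmetric] power_add[symmetric] algebra_simps)
  also have "\<dots> \<le> L ^ (6 * k + 20)" using L1 by (intro power_increasing) simp_all
  finally show ?thesis .
qed

lemma computable_exponent: "computable (\<lambda>k. 6 * k + 20)"
proof -
  let ?P = "Const ''out'' 20 ;; Add ''out'' ''out'' ''n'' ;; Add ''out'' ''out'' ''n'' ;;
    Add ''out'' ''out'' ''n'' ;; Add ''out'' ''out'' ''n'' ;; Add ''out'' ''out'' ''n'' ;;
    Add ''out'' ''out'' ''n''"
  have "wp ?P (\<lambda>t r' m'. r' ''out'' = 6 * k + 20) (fst (nat_input k)) (snd (nat_input k))" for k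
    by (simp add: nat_input_def)
  then show ?thesis unfolding computable_def wp_def by (metis fst_conv prod.collapse)
qed

section \<open>Transport along the numbering of the vertices\<close>

lemma rtrancl_image:
  assumes inj: "inj_on \<phi> I" and R: "R \<subseteq> \<phi> ` I \<times> \<phi> ` I" and S: "S \<subseteq> I"
  defines "Q \<equiv> {(i, j). i \<in> I \<and> j \<in> I \<and> (\<phi> i, \<phi> j) \<in> R}"
  shows "R\<^sup>* `` (\<phi> ` S) = \<phi> ` (Q\<^sup>* `` S)"
proof
  have "\<exists>j \<in> I. v = \<phi> j \<and> (i, j) \<in> Q\<^sup>*" if "(u, v) \<in> R\<^sup>*" "u = \<phi> i" "i \<in> I" for u v i
    using that
  proof (induction rule: rtrancl_induct)
    case (step v w)
    then obtain j where j: "j \<in> I" "v = \<phi> j" "(i, j) \<in> Q\<^sup>*" by blast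
    obtain l where l: "l \<in> I" "w = \<phi> l" using step.hyps(2) R by blast
    have "(j, l) \<in> Q" using j l step.hyps(2) unfolding Q_def by blast
    with j(3) have "(i, l) \<in> Q\<^sup>*" by (rule rtrancl_into_rtrancl)
    then show ?case using l by blast
  qed blast
  then show "R\<^sup>* `` (\<phi> ` S) \<subseteq> \<phi> ` (Q\<^sup>* `` S)" using S by blast
  have "(\<phi> i, \<phi> j) \<in> R\<^sup>*" if "(i, j) \<in> Q\<^sup>*" for i j
    using that
    by (induction rule: rtrancl_induct) (auto simp: Q_def intro: rtrancl_into_rtrancl)
  then show "\<phi> ` (Q\<^sup>* `` S) \<subseteq> R\<^sup>* `` (\<phi> ` S)" by blast
qed

text \<open>Multiplication by the positive denominator gives an integer inequality, and a negative
  numerator is impossible because the left side is nonnegative. The right side has the form of the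
  test in \<open>CostCheck\<close>.\<close>

lemma le_of_rat_iff:
  assumes "quotient_of q = (m, d)"
  shows "real c \<le> real_of_rat q \<longleftrightarrow> \<not> m < 0 \<and> c * nat d \<le> nat \<bar>m\<bar>"
proof -
  have d: "0 < d" using quotient_of_denom_pos[OF assms] .
  have q: "real_of_rat q = real_of_int m / real_of_int d"
    unfolding quotient_of_div[OF assms] by (simp add: of_rat_divide)
  have "real c \<le> real_of_rat q \<longleftrightarrow> real c * real_of_int d \<le> real_of_int m"
    unfolding q using d by (simp add: pos_le_divide_eq)
  also have "\<dots> \<longleftrightarrow> int c * d \<le> m" by (metis of_int_le_iff of_int_mult of_int_of_nat_eq)
  also have "\<dots> \<longleftrightarrow> \<not> m < 0 \<and> c * nat d \<le> nat \<bar>m\<bar>"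
  proof (cases "m < 0")
    case True
    then show ?thesis using d by (smt (verit) of_nat_0_le_iff zero_le_mult_iff)
  next
    case False
    have "c * nat d \<le> nat \<bar>m\<bar> \<longleftrightarrow> int (c * nat d) \<le> int (nat \<bar>m\<bar>)" by linarith
    then show ?thesis using False d by simp
  qed
  finally show ?thesis .
qed

locale coded_instance =
  fixes I :: "'v effectors_instance" and vs
  assumes inst: "I \<in> deterministic_instances"
    and vs: "distinct vs" "set vs = pverts (graph I)"
begin

sublocale influence_graph "graph I" "weight I"
  using inst unfolding deterministic_instances_def effectors_instances_def by simp

definition "n = length vs"
definition "es = map (\<lambda>e. e \<in> parcs (graph I)) (List.product vs vs)"
definition "bs = map (\<lambda>v. v \<in> targets I) vs"
definition "g \<longleftrightarrow> fst (quotient_of (cost I)) < 0"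
definition "u = nat \<bar>fst (quotient_of (cost I))\<bar>"
definition "v = nat (snd (quotient_of (cost I)))"

lemma deterministic: "probabilistic_arcs (graph I) (weight I) = 0"
  using inst unfolding deterministic_instances_def by simp

lemma targets: "targets I \<subseteq> pverts (graph I)"
  using inst unfolding deterministic_instances_def effectors_instances_def by simp

lemma encode: "encode_instance vs I = encode_nat n @ concat (map arc_bits es) @ bs @
    encode_nat (budget I) @ g # encode_nat u @ encode_nat v"
proof -
  have "encode_rat 1 = False # encode_nat 1 @ encode_nat 1" by (simp add: encode_rat_def)
  then have "map (\<lambda>e. if e \<in> parcs (graph I) then True # encode_rat (weight I e) else [False])
      (List.product vs vs) = map arc_bits es"
    unfolding es_def by (auto simp: arc_bits_def weight_eq_1[OF deterministic])
  moreover have "encode_rat (cost I) = g # encode_nat u @ encode_nat v"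
    by (simp add: encode_rat_def g_def u_def v_def split: prod.split)
  ultimately show ?thesis unfolding encode_instance_def n_def bs_def by simp
qed

sublocale parsed_input n "budget I" u v g es bs "encode_instance vs I"
  "{i. i < n \<and> bs ! i}" "{(i, j). i < n \<and> j < n \<and> es ! (n * i + j)}"
  by unfold_locales (use encode in \<open>simp_all add: es_def bs_def n_def\<close>)

abbreviation "A \<equiv> {i. i < n \<and> bs ! i}"
abbreviation "E \<equiv> {(i, j). i < n \<and> j < n \<and> es ! (n * i + j)}"

lemma nth_vs: "inj_on ((!) vs) {..<n}" "(!) vs ` {..<n} = pverts (graph I)"
  using vs by (auto simp: n_def inj_on_nth set_conv_nth image_def)

lemma A: "A \<subseteq> {..<n}" "(!) vs ` A = targets I" "card A = card (targets I)"
proof -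
  show sub: "A \<subseteq> {..<n}" by blast
  have "A = {i. i < n \<and> vs ! i \<in> targets I}" by (auto simp: bs_def n_def)
  then show img: "(!) vs ` A = targets I" using nth_vs(2) targets by auto
  show "card A = card (targets I)"
    unfolding img[symmetric] by (rule card_image[symmetric, OF inj_on_subset[OF nth_vs(1) sub]])
qed

lemma E: "E = {(i, j). i \<in> {..<n} \<and> j \<in> {..<n} \<and> (vs ! i, vs ! j) \<in> parcs (graph I)}"
proof -
  have "es ! (n * i + j) \<longleftrightarrow> (vs ! i, vs ! j) \<in> parcs (graph I)" if "i < n" "j < n" for i j
  proof -
    have "n * i + j < n * Suc i" using that by simp
    also have "\<dots> \<le> n * n" using that by (intro mult_le_mono) auto
    finally have less: "n * i + j < n * n" .
    have "(n * i + j) div n = i" "(n * i + j) mod n = j" using that by simp_all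
    then show ?thesis
      using less product_nth[of "n * i + j" vs vs] by (simp add: es_def n_def[symmetric])
  qed
  then show ?thesis by auto
qed

text \<open>The numbering is injective, so it commutes with reachability, set difference and
  cardinality.\<close>

lemma cost_index:
  assumes "S \<subseteq> {..<n}"
  shows "effector_cost (graph I) (weight I) (targets I) ((!) vs ` S) = card (sym_diff A (E\<^sup>* `` S))"
proof -
  have "parcs (graph I) \<subseteq> (!) vs ` {..<n} \<times> (!) vs ` {..<n}"
    unfolding nth_vs(2) using arc_fst_in_verts arc_snd_in_verts by fastforce
  then have R: "(parcs (graph I))\<^sup>* `` ((!) vs ` S) = (!) vs ` (E\<^sup>* `` S)"
    unfolding E using assms by (rule rtrancl_image[OF nth_vs(1)])
  have sub: "E\<^sup>* `` S \<subseteq> {..<n}" by (rule closure_subset[OF _ assms]) auto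
  have "(!) vs ` (A - E\<^sup>* `` S) = (!) vs ` A - (!) vs ` (E\<^sup>* `` S)"
    "(!) vs ` (E\<^sup>* `` S - A) = (!) vs ` (E\<^sup>* `` S) - (!) vs ` A"
    by (rule inj_on_image_set_diff[OF nth_vs(1)]; use A(1) sub in blast)+
  then have "sym_diff (targets I) ((!) vs ` (E\<^sup>* `` S)) = (!) vs ` sym_diff A (E\<^sup>* `` S)"
    unfolding A(2) image_Un by simp
  moreover have "card ((!) vs ` sym_diff A (E\<^sup>* `` S)) = card (sym_diff A (E\<^sup>* `` S))"
    by (rule card_image, rule inj_on_subset[OF nth_vs(1)]) (use A(1) sub in blast)
  moreover have "(!) vs ` S \<subseteq> pverts (graph I)" using assms nth_vs(2) by blast
  ultimately show ?thesis
    using effector_cost_deterministic[OF deterministic _ targets] by (simp add: R)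
qed

lemma effectors_index:
  "effectors I \<longleftrightarrow> (\<exists>S \<subseteq> {..<n}. card S \<le> budget I \<and>
     real (card (sym_diff A (E\<^sup>* `` S))) \<le> real_of_rat (cost I))"
proof
  assume "effectors I"
  then obtain X where X: "X \<subseteq> pverts (graph I)" "card X \<le> budget I"
    "effector_cost (graph I) (weight I) (targets I) X \<le> real_of_rat (cost I)"
    unfolding effectors_def by blast
  obtain S where S: "S \<subseteq> {..<n}" "X = (!) vs ` S"
    using X(1) unfolding nth_vs(2)[symmetric] by (metis subset_imageE)
  then have card: "card X = card S" using card_image inj_on_subset[OF nth_vs(1)] by blast
  then show "\<exists>S \<subseteq> {..<n}. card S \<le> budget I \<and>
     real (card (sym_diff A (E\<^sup>* `` S))) \<le> real_of_rat (cost I)"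
    using X(2,3) S(1) unfolding S(2) cost_index[OF S(1)] card[unfolded S(2)] by blast
next
  assume "\<exists>S \<subseteq> {..<n}. card S \<le> budget I \<and>
     real (card (sym_diff A (E\<^sup>* `` S))) \<le> real_of_rat (cost I)"
  then obtain S where S: "S \<subseteq> {..<n}" "card S \<le> budget I"
    "real (card (sym_diff A (E\<^sup>* `` S))) \<le> real_of_rat (cost I)" by blast
  have "(!) vs ` S \<subseteq> pverts (graph I)" using S(1) nth_vs(2) by blast
  moreover have "card ((!) vs ` S) = card S" using card_image inj_on_subset[OF nth_vs(1) S(1)] by blast
  ultimately show "effectors I"
    unfolding effectors_def using S(2,3)[folded cost_index[OF S(1)]]
    by (intro exI[of _ "(!) vs ` S"]) simp
qed

lemma effectors_TargetsProgram:
  "effectors I \<longleftrightarrow> (\<exists>S \<subseteq> {..<n}. card S \<le> min (card A) (budget I) \<and>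
     \<not> g \<and> card (sym_diff A (E\<^sup>* `` S)) * v \<le> u)"
proof -
  have cost: "real c \<le> real_of_rat (cost I) \<longleftrightarrow> \<not> g \<and> c * v \<le> u" for c
    unfolding g_def u_def v_def by (rule le_of_rat_iff) simp
  \<comment> \<open>Shrinking \<open>S\<close> as in \<open>few_effectors\<close> makes the error
    set smaller in the sense of inclusion, so the cost bound is kept.\<close>
  have few: "\<exists>T \<subseteq> {..<n}. card T \<le> min (card A) (budget I) \<and> \<not> g \<and> card (sym_diff A (E\<^sup>* `` T)) * v \<le> u"
    if S: "S \<subseteq> {..<n}" "card S \<le> budget I" "\<not> g" "card (sym_diff A (E\<^sup>* `` S)) * v \<le> u" for S
  proof -
    have fin: "finite A" "finite S" using S(1) finite_subset by auto
    obtain T where T: "T \<subseteq> S" "card T \<le> card A" "card T \<le> card S"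
      "sym_diff A (E\<^sup>* `` T) \<subseteq> sym_diff A (E\<^sup>* `` S)"
      using few_effectors[OF fin, of E] by blast
    have "E\<^sup>* `` S \<subseteq> {..<n}" by (rule closure_subset[OF _ S(1)]) auto
    then have "finite (sym_diff A (E\<^sup>* `` S))" using finite_subset fin by blast
    from card_mono[OF this T(4)] have "card (sym_diff A (E\<^sup>* `` T)) * v \<le> u"
      using S(4) by (meson le_trans mult_le_mono1)
    then show ?thesis using S T by (intro exI[of _ T]) auto
  qed
  show ?thesis
    unfolding effectors_index cost
  proof (intro iffI; elim exE conjE)
    fix S assume "S \<subseteq> {..<n}" "card S \<le> min (card A) (budget I)" "\<not> g"
      "card (sym_diff A (E\<^sup>* `` S)) * v \<le> u"
    then show "\<exists>S \<subseteq> {..<n}. card S \<le> budget I \<and> \<not> g \<and> card (sym_diff A (E\<^sup>* `` S)) * v \<le> u"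
      unfolding min.bounded_iff by blast
  qed (rule few)
qed

lemma effectors_CostProgram:
  assumes "cost I = of_nat c"
  shows "u = c" and
    "effectors I \<longleftrightarrow> (\<exists>S \<subseteq> {..<n}. card S \<le> u \<and>
       E\<^sup>* `` prune E (sym_diff A S) n = sym_diff A S \<and> card (prune E (sym_diff A S) n) \<le> budget I)"
proof -
  have "quotient_of (cost I) = (int c, 1)"
    unfolding assms using quotient_of_int[of "int c"] by (simp add: of_int_of_nat_eq)
  then show u: "u = c" by (simp add: u_def)
  have "real d \<le> real_of_rat (cost I) \<longleftrightarrow> d \<le> u" for d
    unfolding assms u by simp
  moreover have "E \<subseteq> {..<n} \<times> {..<n}" by auto
  ultimately show "effectors I \<longleftrightarrow> (\<exists>S \<subseteq> {..<n}. card S \<le> u \<and>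
       E\<^sup>* `` prune E (sym_diff A S) n = sym_diff A S \<and> card (prune E (sym_diff A S) n) \<le> budget I)"
    unfolding effectors_index using guess_errors[OF _ A(1)] by simp
qed

lemma length_bounds: "n < length (encode_instance vs I)" "2 \<le> length (encode_instance vs I)"
  using length_encode_nat[of n] length_encode_nat[of u] unfolding encode
  by (simp_all add: len(2))

end

section \<open>Membership in XP\<close>

lemma answers_within_mono: "answers_within P x c T \<Longrightarrow> T \<le> T' \<Longrightarrow> answers_within P x c T'"
  unfolding answers_within_def using le_trans by blast

text \<open>The enumeration bound \<open>k'\<close> may be smaller than the parameter, since the
  exponent is monotone. The program needs to know only \<open>k'\<close>, which it reads off the
  instance.\<close>

lemma in_XP_I:
  assumes "\<And>I k vs. (I, k) \<in> X \<Longrightarrow> coded_instance I vs \<Longrightarrow>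
      \<exists>k' \<le> k. answers_within P (encode_instance vs I) (effectors I)
        (total_time (length (encode_instance vs I)) (length vs) k')"
    and "\<And>I k. (I, k) \<in> X \<Longrightarrow> I \<in> deterministic_instances"
  shows "in_XP X effectors instance_code"
  unfolding in_XP_def
proof (intro exI[of _ "\<lambda>k. 6 * k + 20"] exI[of _ P] conjI computable_exponent ballI, clarify)
  fix I k x
  assume X: "(I, k) \<in> X" and "instance_code I x"
  then obtain vs where vs: "distinct vs" "set vs = pverts (graph I)" and x: "x = encode_instance vs I"
    unfolding instance_code_def by blast
  interpret coded_instance I vs using vs assms(2)[OF X] by unfold_locales
  obtain k' where k': "k' \<le> k" "answers_within P x (effectors I) (total_time (length x) (length vs) k')"
    using assms(1)[OF X coded_instance_axioms] x by blast
  have "total_time (length x) (length vs) k' \<le> length x ^ (6 * k' + 20)"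
    using total_time_bound length_bounds unfolding x n_def by blast
  also have "\<dots> \<le> length x ^ (6 * k + 20)"
    using k'(1) length_bounds(2) unfolding x by (intro power_increasing) simp_all
  finally show "answers_within P x (effectors I) (length x ^ (6 * k + 20))"
    by (rule answers_within_mono[OF k'(2)])
qed

theorem proposition1:
  shows "in_XP {(I :: 'v effectors_instance, a). I \<in> deterministic_instances \<and> a = card (targets I)}
           effectors instance_code \<and>
         in_XP {(I :: 'v effectors_instance, b). I \<in> deterministic_instances \<and> b = budget I}
           effectors instance_code \<and>
         in_XP {(I :: 'v effectors_instance, c). I \<in> deterministic_instances \<and> of_nat c = cost I}
           effectors instance_code"
proof (intro conjI)
  \<comment> \<open>The minimum is bounded by each of its two arguments, so this single run serves
    as witness for both parameters.\<close>
  have *: "answers_within TargetsProgram (encode_instance vs I) (effectors I)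
      (total_time (length (encode_instance vs I)) (length vs) (min (card (targets I)) (budget I)))"
    if "coded_instance I vs" for I :: "'v effectors_instance" and vs
  proof -
    interpret coded_instance I vs by fact
    show ?thesis
      using TargetsProgram[folded effectors_TargetsProgram, unfolded A(3)] unfolding n_def .
  qed
  show "in_XP {(I :: 'v effectors_instance, a). I \<in> deterministic_instances \<and> a = card (targets I)}
      effectors instance_code"
  proof (rule in_XP_I[where P = TargetsProgram], goal_cases)
    case (1 I k vs)
    then have "min (card (targets I)) (budget I) \<le> k" by auto
    then show ?case using *[OF 1(2)] by blast
  qed auto
  show "in_XP {(I :: 'v effectors_instance, b). I \<in> deterministic_instances \<and> b = budget I}
      effectors instance_code"
  proof (rule in_XP_I[where P = TargetsProgram], goal_cases)
    case (1 I k vs)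
    then have "min (card (targets I)) (budget I) \<le> k" by auto
    then show ?case using *[OF 1(2)] by blast
  qed auto
  have **: "answers_within CostProgram (encode_instance vs I) (effectors I)
      (total_time (length (encode_instance vs I)) (length vs) c)"
    if "coded_instance I vs" "of_nat c = cost I" for I :: "'v effectors_instance" and vs c
  proof -
    interpret coded_instance I vs by fact
    note c = effectors_CostProgram[OF that(2)[symmetric]]
    show ?thesis using CostProgram[folded c(2), unfolded c(1)] unfolding n_def .
  qed
  show "in_XP {(I :: 'v effectors_instance, c). I \<in> deterministic_instances \<and> of_nat c = cost I}
      effectors instance_code"
    by (rule in_XP_I[where P = CostProgram]) (use ** in blast)+
qed

end
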